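(* Let $f:\mathbb{R}^n\to\mathbb{R}$ be convex and continuously differentiable with $L_1$-Lipschitz gradient, and let $x^*$ be a minimizer of $f$ with $f^*=f(x^* )$. Let the noisy objective be $\tilde f(x;\xi)=f(x)+\nu(x;\xi)$, where the noise is i.i.d. (across all evaluations and all $x$) with mean $0$ and variance $\sigma_a^2>0$. Let $\{x_k\}_{k\ge0}$ be generated from an initial point $x_0$ by the STARS iteration $$x_{k+1}=x_k-h\,\frac{\tilde f(x_k+\mu u_k;\xi_k)-\tilde f(x_k;\xi_{k-1})}{\mu}u_k,$$ where $u_0,u_1,\dots$ are independent standard Gaussian vectors in $\mathbb{R}^n$ (mean $0$, covariance $I_n$), independent of the noise, $\tilde f(x_k;\xi_{k-1})$ and $\tilde f(x_k+\mu u_k;\xi_k)$ are noisy evaluations with independent noise, the smoothing stepsize is the constant $\mu=\mu^*=\left[\frac{8\sigma_a^2 n}{L_1^2(n+6)^3}\right]^{1/4}$, and the step length is $h=\frac{1}{4L_1(n+4)}$. Let $\phi_0=f(x_0)$ and $\phi_k=\mathbb{E}[f(x_k)]$ for $k\ge1$, the expectation being over all random directions and noise used up to iteration $k-1$. Then for any $N\ge0$, $$\frac{1}{N+1}\sum_{k=0}^N(\phi_k-f^* )\le\frac{4L_1(n+4)}{N+1}\|x_0-x^*\|^2+\frac{3\sqrt{2}}{5}\sigma_a(n+4).$$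
   Context: $\|\cdot\|$ is the Euclidean norm. "$L_1$-Lipschitz gradient" means $\|\nabla f(x)-\nabla f(y)\|\le L_1\|x-y\|$ for all $x,y$. *)

theory Defs
  imports "HOL-Probability.Probability"
begin

primrec stars_iter ::
  "(real^'n \<Rightarrow> real) \<Rightarrow> real \<Rightarrow> real \<Rightarrow> real^'n \<Rightarrow> (nat \<Rightarrow> real^'n)
   \<Rightarrow> (nat \<Rightarrow> real) \<Rightarrow> (nat \<Rightarrow> real) \<Rightarrow> nat \<Rightarrow> real^'n" where
  "stars_iter f h mu x0 u e0 e1 0 = x0"
| "stars_iter f h mu x0 u e0 e1 (Suc k) =
     (let xk = stars_iter f h mu x0 u e0 e1 k
      in xk - (h * (((f (xk + mu *\<^sub>R u k) + e1 k) - (f xk + e0 k)) / mu)) *\<^sub>R u k)"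

end

theory Submission
  imports Defs "HOL-Real_Asymp.Real_Asymp"
begin

text \<open>
  Write \<open>r\<^sub>k\<close> for the expected squared distance of the \<open>k\<close>-th iterate to the minimizer.  Expanding the
  square and averaging over the fresh noise and direction, Gaussian integration by parts turns the
  cross term into a directional derivative of the smoothed objective, which convexity bounds below by
  \<open>f x - f x*\<close> up to \<open>\<mu>\<^sup>2 L n / 2\<close>; the quadratic term is bounded through the Gaussian moments of order
  at most six and \<open>\<parallel>\<nabla>f x\<parallel>\<^sup>2 \<le> 2 L (f x - f x*)\<close>.  For the given step length this yields
  \<open>r\<^sub>k\<^sub>+\<^sub>1 + h (\<phi>\<^sub>k - f x*) \<le> r\<^sub>k + h c\<close>, which is summed over \<open>k\<close>; the choice of \<open>\<mu>\<close> bounds \<open>c\<close>.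
\<close>

subsection \<open>Convex functions with Lipschitz gradient\<close>

text \<open>The smoothed objective is never differentiated: integration by parts turns the increment
  of \<open>f\<close> along \<open>u\<close>, tested against a vector \<open>d\<close>, into
  \<open>mu\<close> times the mean of \<open>g (x + mu u)\<close> in direction \<open>d\<close>, and
  convexity is then applied pointwise under the expectation.

  The step length satisfies \<open>h * 4 * L * (n + 4) = 1\<close>, so the gradient part of the
  quadratic term costs at most \<open>h\<close> times the gap, half of the gain \<open>2 * h\<close>
  times the gap from the cross term. A small \<open>mu\<close> lowers the smoothing error but
  inflates the noise term \<open>2 * sigma^2 * n / mu^2\<close>; the given \<open>mu\<close> makes
  that term equal to \<open>mu^2 * L^2 * (n + 6)^3 / 4\<close>.

  No integrability of the iterates is assumed. Each step therefore proves a finite second moment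
  together with the inequality, by Tonelli for nonnegative integrands over the independent pair of
  past and fresh randomness. All other integrability rests on polynomial growth in the Gaussian
  direction.\<close>

lemma convex_on_gradient_lower_bound:
  fixes f :: "'a::real_inner \<Rightarrow> real"
  assumes convex: "convex_on UNIV f"
    and grad: "(f has_derivative (\<lambda>v. g \<bullet> v)) (at x)"
  shows "f y \<ge> f x + g \<bullet> (y - x)"
proof -
  \<comment> \<open>On the line through \<open>x\<close> and \<open>y\<close> the claim becomes the
    tangent inequality at \<open>0\<close> for a convex function of one real variable.\<close>
  define F where "F t = f (x + t *\<^sub>R (y - x))" for t :: real
  have "convex_on UNIV F"
  proof (rule convex_onI)
    fix t a b :: real assume t: "0 < t" "t < 1"
    have "x + ((1 - t) *\<^sub>R a + t *\<^sub>R b) *\<^sub>R (y - x)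
        = (1 - t) *\<^sub>R (x + a *\<^sub>R (y - x)) + t *\<^sub>R (x + b *\<^sub>R (y - x))"
      by (simp add: algebra_simps)
    then show "F ((1 - t) *\<^sub>R a + t *\<^sub>R b) \<le> (1 - t) * F a + t * F b"
      unfolding F_def using convex_onD[OF convex, of t] t by simp
  qed simp
  moreover have "(F has_field_derivative g \<bullet> (y - x)) (at 0)"
  proof -
    have "((\<lambda>t::real. x + t *\<^sub>R (y - x)) has_derivative (\<lambda>t. t *\<^sub>R (y - x))) (at 0)"
      by (auto intro!: derivative_eq_intros)
    from has_derivative_compose[OF this, of f "\<lambda>v. g \<bullet> v"] grad
    show ?thesis
      unfolding F_def has_field_derivative_def by (simp add: mult_commute_abs mult.commute)
  qed
  ultimately have "F 1 - F 0 \<ge> (g \<bullet> (y - x)) * (1 - 0)"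
    by (intro convex_on_imp_above_tangent[where A = UNIV]) auto
  then show ?thesis by (simp add: F_def)
qed

locale lipschitz_gradient =
  fixes f :: "'a::real_inner \<Rightarrow> real" and g :: "'a \<Rightarrow> 'a" and L :: real
  assumes grad: "\<And>x. (f has_derivative (\<lambda>v. g x \<bullet> v)) (at x)"
    and lip: "\<And>x y. norm (g x - g y) \<le> L * norm (x - y)"
    and L_pos: "L > 0"
begin

lemma directional_derivative:
  "((\<lambda>t. f (x + t *\<^sub>R d)) has_field_derivative g (x + t *\<^sub>R d) \<bullet> d) (at t)"
proof -
  have "((\<lambda>t::real. x + t *\<^sub>R d) has_derivative (\<lambda>t. t *\<^sub>R d)) (at t)"
    by (auto intro!: derivative_eq_intros)
  from has_derivative_compose[OF this grad[of "x + t *\<^sub>R d"]]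
  show ?thesis
    unfolding has_field_derivative_def by (simp add: mult_commute_abs mult.commute)
qed

text \<open>Along the segment from \<open>x\<close> to \<open>y\<close>, the gap \<open>F\<close>
  between \<open>f\<close> and its quadratic model has nonpositive derivative, by Cauchy-Schwarz and
  the Lipschitz bound; the claim compares its two ends.\<close>

lemma descent:
  "f y \<le> f x + g x \<bullet> (y - x) + L / 2 * (norm (y - x))\<^sup>2"
proof -
  define d where "d = y - x"
  define F where "F t = f (x + t *\<^sub>R d) - t * (g x \<bullet> d) - L / 2 * t\<^sup>2 * (norm d)\<^sup>2" for t
  have "F 1 \<le> F 0"
  proof (rule DERIV_nonpos_imp_nonincreasing[of 0 1 F])
    fix t :: real assume t: "0 \<le> t"
    have "(F has_field_derivative (g (x + t *\<^sub>R d) \<bullet> d - g x \<bullet> d - L * t * (norm d)\<^sup>2)) (at t)"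
      unfolding F_def by (auto intro!: derivative_eq_intros directional_derivative)
    moreover have "g (x + t *\<^sub>R d) \<bullet> d - g x \<bullet> d - L * t * (norm d)\<^sup>2 \<le> 0"
    proof -
      have "(g (x + t *\<^sub>R d) - g x) \<bullet> d \<le> norm (g (x + t *\<^sub>R d) - g x) * norm d"
        by (rule norm_cauchy_schwarz)
      also have "\<dots> \<le> (L * norm (t *\<^sub>R d)) * norm d"
        using lip[of "x + t *\<^sub>R d" x] by (intro mult_right_mono) auto
      finally show ?thesis using t by (simp add: inner_diff_left power2_eq_square algebra_simps)
    qed
    ultimately show "\<exists>y. DERIV F t :> y \<and> y \<le> 0" by blast
  qed simp
  then show ?thesis by (simp add: F_def d_def)
qed

lemma continuous_gradient: "continuous_on UNIV g"
proof (rule lipschitz_on_continuous_on[of L])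
  show "L-lipschitz_on UNIV g"
    by (rule lipschitz_onI) (use lip L_pos in \<open>auto simp: dist_norm\<close>)
qed

lemma continuous: "continuous_on UNIV f"
  using grad has_derivative_continuous continuous_at_imp_continuous_on by blast

text \<open>A gradient step of length \<open>1 / L\<close> lowers \<open>f\<close> by at least
  \<open>(norm (g x))^2 / (2 * L)\<close> and still cannot fall below \<open>m\<close>.\<close>

lemma norm_gradient_sq_le:
  assumes "\<And>x. m \<le> f x"
  shows "(norm (g x))\<^sup>2 \<le> 2 * L * (f x - m)"
proof -
  have "m \<le> f (x - (1 / L) *\<^sub>R g x)" by (rule assms)
  also have "\<dots> \<le> f x + g x \<bullet> (x - (1 / L) *\<^sub>R g x - x) + L / 2 * (norm (x - (1 / L) *\<^sub>R g x - x))\<^sup>2"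
    by (rule descent)
  also have "\<dots> = f x - (norm (g x))\<^sup>2 / (2 * L)"
    using L_pos
    by (simp add: power_mult_distrib power_divide field_simps flip: power2_norm_eq_inner)
       (simp add: power2_eq_square field_simps)
  finally show ?thesis using L_pos by (simp add: field_simps)
qed

end

subsection \<open>Gaussian integration by parts\<close>

lemma integrable_std_normal_poly:
  "integrable lborel (\<lambda>t. std_normal_density t * (a + b * \<bar>t\<bar>) ^ p)"
proof -
  have "(\<lambda>t. std_normal_density t * (a + b * \<bar>t\<bar>) ^ p) =
    (\<lambda>t. \<Sum>k\<le>p. (of_nat (p choose k) * a ^ k * b ^ (p - k)) * (std_normal_density t * \<bar>t\<bar> ^ (p - k)))"
    by (simp add: binomial_ring sum_distrib_left power_mult_distrib mult_ac)
  then show ?thesis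
    by (simp add: integrable_std_normal_moment_abs)
qed

lemma DERIV_std_normal_density:
  "(std_normal_density has_field_derivative - t * std_normal_density t) (at t)"
  unfolding std_normal_density_def
  by (rule DERIV_cong, rule DERIV_cmult, rule derivative_eq_intros refl)+
     (auto intro!: derivative_eq_intros)

text \<open>A single term of the exponential series gives
  \<open>(1 + t)^p \<le> p! * exp (1 + t)\<close>, which trades the symbolic exponent for a fixed
  function that the density dominates.\<close>

lemma poly_times_std_normal_density_tendsto_0:
  "((\<lambda>t. (1 + t) ^ p * std_normal_density t) \<longlongrightarrow> 0) at_top"
proof (rule tendsto_sandwich[OF _ _ tendsto_const])
  show "\<forall>\<^sub>F t in at_top. 0 \<le> (1 + t) ^ p * std_normal_density t"
    using eventually_ge_at_top[of 0] by eventually_elim simp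
  show "\<forall>\<^sub>F t in at_top. (1 + t) ^ p * std_normal_density t
      \<le> fact p * (exp (1 + t) * std_normal_density t)"
    using eventually_ge_at_top[of 0]
  proof eventually_elim
    case (elim t)
    have "(\<Sum>k\<in>{p}. (1 + t) ^ k /\<^sub>R fact k) \<le> exp (1 + t)"
      using elim summable_exp_generic[of "1 + t"]
      unfolding exp_def by (intro sum_le_suminf) auto
    then have "(1 + t) ^ p \<le> fact p * exp (1 + t)" by (simp add: field_simps)
    from mult_right_mono[OF this, of "std_normal_density t"] show ?case by (simp add: mult_ac)
  qed
  show "((\<lambda>t. fact p * (exp (1 + t) * std_normal_density t)) \<longlongrightarrow> 0) at_top"
    unfolding std_normal_density_def by real_asymp
qed

text \<open>The difference of the two integrands is the derivative \<open>F'\<close> of density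
  times \<open>\<psi>\<close>. Its integral over \<open>[-n, n]\<close> is a difference of boundary
  values, which vanish as \<open>n\<close> grows; dominated convergence passes to the whole
  line.\<close>

lemma std_normal_stein:
  fixes \<psi> \<psi>' :: "real \<Rightarrow> real"
  assumes deriv: "\<And>t. (\<psi> has_field_derivative \<psi>' t) (at t)"
    and cont: "continuous_on UNIV \<psi>'"
    and bound: "\<And>t. \<bar>\<psi> t\<bar> \<le> C * (1 + \<bar>t\<bar>) ^ p"
    and bound': "\<And>t. \<bar>\<psi>' t\<bar> \<le> C' * (1 + \<bar>t\<bar>) ^ q"
  shows "(\<integral>t. std_normal_density t * (\<psi> t * t) \<partial>lborel) = (\<integral>t. std_normal_density t * \<psi>' t \<partial>lborel)"
proof -
  define F where "F t = std_normal_density t * \<psi> t" for t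
  define F' where "F' t = std_normal_density t * \<psi>' t - std_normal_density t * (\<psi> t * t)" for t
  have C: "C \<ge> 0" "C' \<ge> 0"
    using bound[of 0] bound'[of 0] by auto
  have cont\<psi>: "continuous_on UNIV \<psi>"
    using deriv DERIV_isCont continuous_at_imp_continuous_on by blast
  have [measurable]: "\<psi> \<in> borel_measurable borel" "\<psi>' \<in> borel_measurable borel"
    using cont cont\<psi> by (auto intro: borel_measurable_continuous_onI)
  have int': "integrable lborel (\<lambda>t. std_normal_density t * \<psi>' t)"
  proof (rule Bochner_Integration.integrable_bound)
    show "integrable lborel (\<lambda>t. C' * (std_normal_density t * (1 + 1 * \<bar>t\<bar>) ^ q))"
      by (intro integrable_mult_right integrable_std_normal_poly)
    show "AE t in lborel. norm (std_normal_density t * \<psi>' t)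
        \<le> norm (C' * (std_normal_density t * (1 + 1 * \<bar>t\<bar>) ^ q))"
      using mult_left_mono[OF bound', of "std_normal_density t" t for t] C
      by (simp add: abs_mult mult_ac)
  qed simp
  have int: "integrable lborel (\<lambda>t. std_normal_density t * (\<psi> t * t))"
  proof (rule Bochner_Integration.integrable_bound)
    show "integrable lborel (\<lambda>t. C * (std_normal_density t * (1 + 1 * \<bar>t\<bar>) ^ (p + 1)))"
      by (intro integrable_mult_right integrable_std_normal_poly)
    have *: "\<bar>\<psi> t\<bar> * \<bar>t\<bar> \<le> (C * (1 + \<bar>t\<bar>) ^ p) * (1 + \<bar>t\<bar>)" for t
      by (intro mult_mono bound) (use C in auto)
    show "AE t in lborel. norm (std_normal_density t * (\<psi> t * t))
        \<le> norm (C * (std_normal_density t * (1 + 1 * \<bar>t\<bar>) ^ (p + 1)))"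
      using mult_left_mono[OF *, of "std_normal_density t" t for t] C
      by (simp add: abs_mult mult_ac)
  qed simp
  have intF': "integrable lborel F'"
    unfolding F'_def using int int' by (rule Bochner_Integration.integrable_diff[rotated])
  have derivF: "(F has_field_derivative F' t) (at t)" for t
    unfolding F_def F'_def
    by (auto intro!: derivative_eq_intros DERIV_std_normal_density deriv)
  have contF': "continuous_on A F'" for A
  proof -
    have "continuous_on A std_normal_density"
      using DERIV_std_normal_density DERIV_isCont continuous_at_imp_continuous_on by blast
    then show ?thesis unfolding F'_def
      by (intro continuous_intros continuous_on_subset[OF cont] continuous_on_subset[OF cont\<psi>]) auto
  qed
  \<comment> \<open>The sign \<open>s\<close> treats both ends of the interval at once, as the
    density is even.\<close>
  have limF: "(\<lambda>n. F (s * real n)) \<longlonglongrightarrow> 0" if s: "\<bar>s\<bar> = 1" for s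
  proof (rule Lim_null_comparison)
    show "\<forall>\<^sub>F n in sequentially. norm (F (s * real n)) \<le> C * ((1 + real n) ^ p * std_normal_density (real n))"
    proof (rule always_eventually, rule allI)
      fix n
      have "std_normal_density (s * real n) = std_normal_density (real n)"
        using s unfolding std_normal_density_def by (metis abs_mult mult_1 power2_abs)
      then show "norm (F (s * real n)) \<le> C * ((1 + real n) ^ p * std_normal_density (real n))"
        using mult_left_mono[OF bound[of "s * real n"], of "std_normal_density (real n)"] s
        by (simp add: F_def abs_mult mult_ac)
    qed
    show "(\<lambda>n. C * ((1 + real n) ^ p * std_normal_density (real n))) \<longlonglongrightarrow> 0"
      by (intro tendsto_mult_right_zero filterlim_compose[OF poly_times_std_normal_density_tendsto_0]
          filterlim_real_sequentially)
  qed
  have "(\<lambda>n. \<integral>t. indicator {- real n..real n} t *\<^sub>R F' t \<partial>lborel) \<longlonglongrightarrow> (\<integral>t. F' t \<partial>lborel)"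
  proof (rule integral_dominated_convergence[where w = "\<lambda>t. norm (F' t)"])
    show "AE t in lborel. (\<lambda>n. indicator {- real n..real n} t *\<^sub>R F' t) \<longlonglongrightarrow> F' t"
    proof (rule AE_I2, rule tendsto_eventually)
      fix t :: real
      show "\<forall>\<^sub>F n in sequentially. indicator {- real n..real n} t *\<^sub>R F' t = F' t"
        using eventually_ge_at_top[of "nat \<lceil>\<bar>t\<bar>\<rceil>"]
        by eventually_elim (auto simp: indicator_def abs_le_iff nat_le_iff ceiling_le_iff)
    qed
  qed (use intF' borel_measurable_integrable[OF intF'] in \<open>auto simp: indicator_def\<close>)
  moreover have "(\<integral>t. indicator {- real n..real n} t *\<^sub>R F' t \<partial>lborel) = F (1 * real n) - F ((-1) * real n)" for n
    using derivF contF'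
    by (subst integral_FTC_atLeastAtMost[where F = F])
       (auto simp: has_real_derivative_iff_has_vector_derivative[symmetric] intro: has_field_derivative_at_within)
  moreover have "(\<lambda>n. F (1 * real n) - F ((-1) * real n)) \<longlonglongrightarrow> 0 - 0"
    by (intro tendsto_diff limF) auto
  ultimately have "(\<integral>t. F' t \<partial>lborel) = 0"
    using LIMSEQ_unique by fastforce
  then show ?thesis
    using int int' unfolding F'_def by simp
qed

subsection \<open>Independence\<close>

text \<open>\<^const>\<open>prob_space.indep_var\<close> forces both variables to take values in the same type.\<close>

definition (in prob_space) indep_pair ::
  "'b measure \<Rightarrow> ('a \<Rightarrow> 'b) \<Rightarrow> 'c measure \<Rightarrow> ('a \<Rightarrow> 'c) \<Rightarrow> bool" where
  "indep_pair S X T Y \<longleftrightarrow> random_variable S X \<and> random_variable T Y \<and>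
     distr M S X \<Otimes>\<^sub>M distr M T Y = distr M (S \<Otimes>\<^sub>M T) (\<lambda>\<omega>. (X \<omega>, Y \<omega>))"

lemma (in prob_space) indep_pair_compose:
  assumes indep: "indep_pair S X T Y"
    and [measurable]: "p \<in> measurable S S'" "q \<in> measurable T T'"
  shows "indep_pair S' (\<lambda>\<omega>. p (X \<omega>)) T' (\<lambda>\<omega>. q (Y \<omega>))"
proof -
  have [measurable]: "X \<in> measurable M S" "Y \<in> measurable M T"
    using indep by (auto simp: indep_pair_def)
  interpret Y: prob_space "distr (distr M T Y) T' q"
    by (intro prob_space.prob_space_distr prob_space_distr) simp_all
  have "distr M S' (\<lambda>\<omega>. p (X \<omega>)) \<Otimes>\<^sub>M distr M T' (\<lambda>\<omega>. q (Y \<omega>))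
      = distr (distr M S X) S' p \<Otimes>\<^sub>M distr (distr M T Y) T' q"
    by (simp add: distr_distr comp_def)
  also have "\<dots> = distr (distr M S X \<Otimes>\<^sub>M distr M T Y) (S' \<Otimes>\<^sub>M T') (\<lambda>(x, y). (p x, q y))"
    by (rule pair_measure_distr) (simp_all add: Y.sigma_finite_measure_axioms)
  also have "\<dots> = distr M (S' \<Otimes>\<^sub>M T') (\<lambda>\<omega>. (p (X \<omega>), q (Y \<omega>)))"
    using indep by (simp add: indep_pair_def distr_distr comp_def)
  finally show ?thesis by (simp add: indep_pair_def)
qed

text \<open>Tonelli on the product of the two laws. No finiteness is presupposed, so integrability
  can be deduced from it.\<close>

lemma (in prob_space) indep_pair_nn_integral:
  assumes indep: "indep_pair S X T Y"
    and [measurable]: "F \<in> borel_measurable (S \<Otimes>\<^sub>M T)"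
  shows "(\<integral>\<^sup>+\<omega>. F (X \<omega>, Y \<omega>) \<partial>M) = (\<integral>\<^sup>+\<omega>. (\<integral>\<^sup>+\<omega>'. F (X \<omega>, Y \<omega>') \<partial>M) \<partial>M)"
proof -
  have [measurable]: "X \<in> measurable M S" "Y \<in> measurable M T"
    using indep by (auto simp: indep_pair_def)
  interpret Y: prob_space "distr M T Y" by (rule prob_space_distr) simp
  have "(\<integral>\<^sup>+\<omega>. F (X \<omega>, Y \<omega>) \<partial>M) = (\<integral>\<^sup>+z. F z \<partial>distr M (S \<Otimes>\<^sub>M T) (\<lambda>\<omega>. (X \<omega>, Y \<omega>)))"
    by (simp add: nn_integral_distr)
  also have "\<dots> = (\<integral>\<^sup>+z. F z \<partial>(distr M S X \<Otimes>\<^sub>M distr M T Y))"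
    using indep by (simp add: indep_pair_def)
  also have "\<dots> = (\<integral>\<^sup>+x. (\<integral>\<^sup>+y. F (x, y) \<partial>distr M T Y) \<partial>distr M S X)"
    by (rule Y.nn_integral_fst[symmetric]) simp
  also have "\<dots> = (\<integral>\<^sup>+\<omega>. (\<integral>\<^sup>+y. F (X \<omega>, y) \<partial>distr M T Y) \<partial>M)"
    by (rule nn_integral_distr) simp_all
  also have "\<dots> = (\<integral>\<^sup>+\<omega>. (\<integral>\<^sup>+\<omega>'. F (X \<omega>, Y \<omega>') \<partial>M) \<partial>M)"
    by (intro nn_integral_cong nn_integral_distr measurable_Pair2[of F S T])
       (auto intro: measurable_space[of X M S])
  finally show ?thesis .
qed

lemma (in prob_space) indep_pair_integral:
  fixes F :: "_ \<Rightarrow> real"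
  assumes indep: "indep_pair S X T Y"
    and [measurable]: "F \<in> borel_measurable (S \<Otimes>\<^sub>M T)"
    and int: "integrable M (\<lambda>\<omega>. F (X \<omega>, Y \<omega>))"
  shows "(\<integral>\<omega>. F (X \<omega>, Y \<omega>) \<partial>M) = (\<integral>\<omega>. (\<integral>\<omega>'. F (X \<omega>, Y \<omega>') \<partial>M) \<partial>M)"
proof -
  have [measurable]: "X \<in> measurable M S" "Y \<in> measurable M T"
    using indep by (auto simp: indep_pair_def)
  interpret X: prob_space "distr M S X" by (rule prob_space_distr) simp
  interpret Y: prob_space "distr M T Y" by (rule prob_space_distr) simp
  interpret XY: pair_sigma_finite "distr M S X" "distr M T Y" ..
  have eq: "distr M (S \<Otimes>\<^sub>M T) (\<lambda>\<omega>. (X \<omega>, Y \<omega>)) = distr M S X \<Otimes>\<^sub>M distr M T Y"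
    using indep by (simp add: indep_pair_def)
  have "(\<integral>\<omega>. F (X \<omega>, Y \<omega>) \<partial>M) = (\<integral>z. F z \<partial>distr M (S \<Otimes>\<^sub>M T) (\<lambda>\<omega>. (X \<omega>, Y \<omega>)))"
    by (simp add: integral_distr)
  also have "\<dots> = (\<integral>x. (\<integral>y. F (x, y) \<partial>distr M T Y) \<partial>distr M S X)"
    unfolding eq using int by (intro XY.integral_fst'[symmetric]) (simp add: eq[symmetric] integrable_distr_eq)
  also have "\<dots> = (\<integral>\<omega>. (\<integral>y. F (X \<omega>, y) \<partial>distr M T Y) \<partial>M)"
    by (rule integral_distr) simp_all
  also have "\<dots> = (\<integral>\<omega>. (\<integral>\<omega>'. F (X \<omega>, Y \<omega>') \<partial>M) \<partial>M)"
    by (intro Bochner_Integration.integral_cong integral_distr measurable_Pair2[of F S T])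
       (auto intro: measurable_space[of X M S])
  finally show ?thesis .
qed

text \<open>Functions of disjoint blocks of an independent family are independent. \<open>p\<close>
  and \<open>q\<close> rebuild \<open>U\<close> and \<open>V\<close> from the restricted blocks,
  because elements of a product space are undefined outside the index set.\<close>

lemma (in prob_space) indep_vars_imp_indep_pair:
  assumes indep: "indep_vars M' X I"
    and AB: "A \<inter> B = {}" "A \<subseteq> I" "B \<subseteq> I"
    and p: "p \<in> measurable (PiM A M') S" "\<And>\<omega>. p (restrict (\<lambda>i. X i \<omega>) A) = U \<omega>"
    and q: "q \<in> measurable (PiM B M') T" "\<And>\<omega>. q (restrict (\<lambda>i. X i \<omega>) B) = V \<omega>"
  shows "indep_pair S U T V"
proof -
  have "indep_pair (PiM A M') (\<lambda>\<omega>. restrict (\<lambda>i. X i \<omega>) A) (PiM B M') (\<lambda>\<omega>. restrict (\<lambda>i. X i \<omega>) B)"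
    using indep_var_restrict[OF indep AB] by (simp add: indep_pair_def indep_var_distribution_eq)
  from indep_pair_compose[OF this p(1) q(1)] show ?thesis by (simp add: p(2) q(2))
qed

lemma (in prob_space) indep_pair_imp_indep_var:
  fixes X :: "'a \<Rightarrow> 'b" and Y :: "'a \<Rightarrow> 'b"
  assumes "indep_pair S X T Y"
  shows "indep_var S X T Y"
  using assms by (simp add: indep_pair_def indep_var_distribution_eq)

text \<open>After composition with \<open>p\<close> and \<open>q\<close> both variables are real, so
  the product rule for \<open>indep_var\<close> applies although \<open>X\<close> and
  \<open>Y\<close> may differ in type.\<close>

lemma (in prob_space)
  fixes p :: "'b \<Rightarrow> real" and q :: "'c \<Rightarrow> real"
  assumes indep: "indep_pair S X T Y"
    and "p \<in> borel_measurable S" "q \<in> borel_measurable T"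
    and int: "integrable M (\<lambda>\<omega>. p (X \<omega>))" "integrable M (\<lambda>\<omega>. q (Y \<omega>))"
  shows indep_pair_mult_integrable: "integrable M (\<lambda>\<omega>. p (X \<omega>) * q (Y \<omega>))"
    and indep_pair_expectation_mult:
      "expectation (\<lambda>\<omega>. p (X \<omega>) * q (Y \<omega>)) = expectation (\<lambda>\<omega>. p (X \<omega>)) * expectation (\<lambda>\<omega>. q (Y \<omega>))"
proof -
  have "indep_var borel (\<lambda>\<omega>. p (X \<omega>)) borel (\<lambda>\<omega>. q (Y \<omega>))"
    by (rule indep_pair_imp_indep_var[OF indep_pair_compose]) fact+
  with int show "integrable M (\<lambda>\<omega>. p (X \<omega>) * q (Y \<omega>))"
    "expectation (\<lambda>\<omega>. p (X \<omega>) * q (Y \<omega>)) = expectation (\<lambda>\<omega>. p (X \<omega>)) * expectation (\<lambda>\<omega>. q (Y \<omega>))"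
    by (simp_all add: indep_var_integrable indep_var_lebesgue_integral)
qed

text \<open>Replaces conditioning on \<open>X\<close>: the bound is proved with \<open>X\<close>
  frozen at \<open>x\<close> and integrated afterwards. Integrability of the composite is a
  conclusion, which is what carries the second moment from one iterate to the next.\<close>

lemma (in prob_space) indep_pair_expectation_le:
  fixes F :: "_ \<Rightarrow> real"
  assumes indep: "indep_pair S X T Y"
    and [measurable]: "F \<in> borel_measurable (S \<Otimes>\<^sub>M T)"
    and nonneg: "\<And>z. 0 \<le> F z"
    and int: "\<And>x. integrable M (\<lambda>\<omega>. F (x, Y \<omega>))"
    and le: "\<And>x. expectation (\<lambda>\<omega>. F (x, Y \<omega>)) \<le> G x"
    and intG: "integrable M (\<lambda>\<omega>. G (X \<omega>))"
  shows "integrable M (\<lambda>\<omega>. F (X \<omega>, Y \<omega>))"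
    and "expectation (\<lambda>\<omega>. F (X \<omega>, Y \<omega>)) \<le> expectation (\<lambda>\<omega>. G (X \<omega>))"
proof -
  have [measurable]: "X \<in> measurable M S" "Y \<in> measurable M T"
    using indep by (auto simp: indep_pair_def)
  \<comment> \<open>\<open>G\<close> inherits nonnegativity from \<open>F\<close>, so its
    expectation is a nonnegative integral.\<close>
  have G: "0 \<le> G x" for x
    using order_trans[OF Bochner_Integration.integral_nonneg le[of x]] nonneg by simp
  have "(\<integral>\<^sup>+\<omega>. ennreal (F (X \<omega>, Y \<omega>)) \<partial>M) = (\<integral>\<^sup>+\<omega>. (\<integral>\<^sup>+\<omega>'. ennreal (F (X \<omega>, Y \<omega>')) \<partial>M) \<partial>M)"
    by (rule indep_pair_nn_integral[OF indep]) simp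
  also have "\<dots> \<le> (\<integral>\<^sup>+\<omega>. ennreal (G (X \<omega>)) \<partial>M)"
    using int nonneg le by (intro nn_integral_mono) (simp add: nn_integral_eq_integral ennreal_leI)
  also have "\<dots> = ennreal (expectation (\<lambda>\<omega>. G (X \<omega>)))"
    using intG G by (intro nn_integral_eq_integral) auto
  finally have *: "(\<integral>\<^sup>+\<omega>. ennreal (F (X \<omega>, Y \<omega>)) \<partial>M) \<le> ennreal (expectation (\<lambda>\<omega>. G (X \<omega>)))" .
  show int: "integrable M (\<lambda>\<omega>. F (X \<omega>, Y \<omega>))"
    using nonneg le_less_trans[OF *] by (intro integrableI_nonneg) auto
  show "expectation (\<lambda>\<omega>. F (X \<omega>, Y \<omega>)) \<le> expectation (\<lambda>\<omega>. G (X \<omega>))"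
    using * nonneg G by (subst (asm) nn_integral_eq_integral[OF int]) (auto simp: Bochner_Integration.integral_nonneg)
qed

subsection \<open>Standard Gaussian vectors\<close>

lemma borel_measurable_vec_lambda:
  fixes F :: "'n::finite \<Rightarrow> 'a \<Rightarrow> real"
  assumes [measurable]: "\<And>i. F i \<in> borel_measurable M"
  shows "(\<lambda>\<omega>. \<chi> i. F i \<omega>) \<in> borel_measurable M"
proof (subst borel_measurable_euclidean_space, rule ballI)
  fix b :: "real^'n" assume "b \<in> Basis"
  then obtain i where "b = axis i 1" by (auto simp: Basis_vec_def)
  then show "(\<lambda>\<omega>. (\<chi> i. F i \<omega>) \<bullet> b) \<in> borel_measurable M"
    by (simp add: inner_axis)
qed

locale standard_gaussian_vector = prob_space M
  for M :: "'a measure" +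
  fixes u :: "'a \<Rightarrow> real^'n"
  assumes comp_indep: "indep_vars (\<lambda>_. borel) (\<lambda>i \<omega>. u \<omega> $ i) UNIV"
    and comp_normal: "\<And>i. distributed M lborel (\<lambda>\<omega>. u \<omega> $ i) std_normal_density"
begin

lemma measurable_comp [measurable]: "(\<lambda>\<omega>. u \<omega> $ i) \<in> borel_measurable M"
  using distributed_measurable[OF comp_normal[of i]] by simp

lemma measurable_vec [measurable]: "u \<in> borel_measurable M"
  using borel_measurable_vec_lambda[of "\<lambda>i \<omega>. u \<omega> $ i" M] by simp

text \<open>The norm is at most \<open>n\<close> times the largest coordinate in absolute value. The
  power for that coordinate is one summand of the sum over all coordinates, and each summand is a
  one-dimensional Gaussian moment.\<close>

lemma integrable_poly_growth:
  assumes [measurable]: "\<phi> \<in> borel_measurable borel"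
    and bound: "\<And>v. \<bar>\<phi> v\<bar> \<le> C * (1 + norm v) ^ p"
  shows "integrable M (\<lambda>\<omega>. \<phi> (u \<omega>))"
proof -
  let ?n = "real CARD('n)"
  have "C \<ge> 0" using bound[of 0] by simp
  have le: "(1 + norm v) ^ p \<le> (\<Sum>i\<in>UNIV. (1 + ?n * \<bar>v $ i\<bar>) ^ p)" for v :: "real^'n"
  proof -
    have "Max (range (\<lambda>i. \<bar>v $ i\<bar>)) \<in> range (\<lambda>i. \<bar>v $ i\<bar>)" by (rule Max_in) auto
    then obtain j where "Max (range (\<lambda>i. \<bar>v $ i\<bar>)) = \<bar>v $ j\<bar>" by blast
    then have j: "\<bar>v $ i\<bar> \<le> \<bar>v $ j\<bar>" for i
      using Max_ge[of "range (\<lambda>i. \<bar>v $ i\<bar>)" "\<bar>v $ i\<bar>"] by simp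
    have "norm v \<le> (\<Sum>i\<in>UNIV. \<bar>v $ i\<bar>)" by (rule norm_le_l1_cart)
    also have "\<dots> \<le> (\<Sum>i\<in>(UNIV::'n set). \<bar>v $ j\<bar>)" by (intro sum_mono j)
    finally have "(1 + norm v) ^ p \<le> (1 + ?n * \<bar>v $ j\<bar>) ^ p"
      by (intro power_mono) auto
    also have "\<dots> \<le> (\<Sum>i\<in>UNIV. (1 + ?n * \<bar>v $ i\<bar>) ^ p)"
      by (rule member_le_sum[where f = "\<lambda>i. (1 + ?n * \<bar>v $ i\<bar>) ^ p"]) auto
    finally show ?thesis .
  qed
  have int: "integrable M (\<lambda>\<omega>. (1 + ?n * \<bar>u \<omega> $ i\<bar>) ^ p)" for i
    using integrable_std_normal_poly[of 1 ?n p]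
    by (subst distributed_integrable[OF comp_normal[of i], symmetric]) auto
  show ?thesis
  proof (rule Bochner_Integration.integrable_bound)
    show "integrable M (\<lambda>\<omega>. C * (\<Sum>i\<in>UNIV. (1 + ?n * \<bar>u \<omega> $ i\<bar>) ^ p))"
      using int by simp
    show "AE \<omega> in M. norm (\<phi> (u \<omega>)) \<le> norm (C * (\<Sum>i\<in>UNIV. (1 + ?n * \<bar>u \<omega> $ i\<bar>) ^ p))"
    proof (rule AE_I2)
      fix \<omega>
      have "norm (\<phi> (u \<omega>)) \<le> C * (\<Sum>i\<in>UNIV. (1 + ?n * \<bar>u \<omega> $ i\<bar>) ^ p)"
        using order_trans[OF bound mult_left_mono[OF le \<open>C \<ge> 0\<close>]] by simp
      then show "norm (\<phi> (u \<omega>)) \<le> norm (C * (\<Sum>i\<in>UNIV. (1 + ?n * \<bar>u \<omega> $ i\<bar>) ^ p))"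
        by simp
    qed
  qed simp
qed

text \<open>Zeroing coordinate \<open>i\<close> leaves a function of the other coordinates only.
  This splits \<open>u\<close> into an independent vector and scalar, as \<open>stein\<close>
  requires.\<close>

lemma indep_complement_comp:
  "indep_pair borel (\<lambda>\<omega>. u \<omega> - (u \<omega> $ i) *\<^sub>R (axis i 1 :: real^'n)) borel (\<lambda>\<omega>. u \<omega> $ i)"
proof (rule indep_vars_imp_indep_pair[OF comp_indep, where A = "UNIV - {i}" and B = "{i}"
      and p = "\<lambda>z. \<chi> j. if j = i then 0 else z j" and q = "\<lambda>z. z i"])
  show "(\<lambda>z :: 'n \<Rightarrow> real. \<chi> j. if j = i then 0 else z j) \<in> borel_measurable (PiM (UNIV - {i}) (\<lambda>_. borel))"
  proof (rule borel_measurable_vec_lambda)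
    fix j show "(\<lambda>z :: 'n \<Rightarrow> real. if j = i then 0 else z j) \<in> borel_measurable (PiM (UNIV - {i}) (\<lambda>_. borel))"
      by (cases "j = i") auto
  qed
qed (auto simp: vec_eq_iff axis_def)

lemma stein:
  assumes deriv: "\<And>v. (\<phi> has_derivative (\<lambda>w. G v \<bullet> w)) (at v)"
    and cont: "continuous_on UNIV G"
    and bound: "\<And>v. \<bar>\<phi> v\<bar> \<le> C * (1 + norm v) ^ p"
    and bound': "\<And>v. norm (G v) \<le> C' * (1 + norm v) ^ q"
  shows "expectation (\<lambda>\<omega>. \<phi> (u \<omega>) * u \<omega> $ i) = expectation (\<lambda>\<omega>. G (u \<omega>) $ i)"
proof -
  let ?e = "axis i 1 :: real^'n"
  let ?V = "\<lambda>\<omega>. u \<omega> - (u \<omega> $ i) *\<^sub>R ?e"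
  have C: "C \<ge> 0" "C' \<ge> 0"
    using bound[of 0] order_trans[OF norm_ge_zero bound'[of 0]] by auto
  have "continuous_on UNIV \<phi>"
    using deriv has_derivative_continuous continuous_at_imp_continuous_on by blast
  then have [measurable]: "\<phi> \<in> borel_measurable borel" "G \<in> borel_measurable borel"
    using cont by (auto intro: borel_measurable_continuous_onI)
  have contG: "continuous_on UNIV (\<lambda>v. G v $ i)"
    by (intro continuous_intros cont)
  then have [measurable]: "(\<lambda>v. G v $ i) \<in> borel_measurable borel"
    by (rule borel_measurable_continuous_onI)
  have boundG: "\<bar>G v $ i\<bar> \<le> C' * (1 + norm v) ^ q" for v
    using order_trans[OF component_le_norm_cart bound'] .
  have int: "integrable M (\<lambda>\<omega>. \<phi> (u \<omega>) * u \<omega> $ i)"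
  proof (rule integrable_poly_growth)
    fix v :: "real^'n"
    have "\<bar>\<phi> v * v $ i\<bar> \<le> (C * (1 + norm v) ^ p) * (1 + norm v)"
      unfolding abs_mult using component_le_norm_cart[of v i] C
      by (intro mult_mono bound) auto
    then show "\<bar>\<phi> v * v $ i\<bar> \<le> C * (1 + norm v) ^ (p + 1)" by (simp add: mult_ac)
  qed simp
  have int': "integrable M (\<lambda>\<omega>. G (u \<omega>) $ i)"
    by (rule integrable_poly_growth[of "\<lambda>v. G v $ i", OF _ boundG]) simp
  have shift: "(1 + norm (v + t *\<^sub>R ?e)) ^ r \<le> (1 + norm v) ^ r * (1 + \<bar>t\<bar>) ^ r" for v t r
  proof -
    have "norm (v + t *\<^sub>R ?e) \<le> norm v + \<bar>t\<bar>"
      using norm_triangle_ineq[of v "t *\<^sub>R ?e"] by simp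
    moreover have "0 \<le> norm v * \<bar>t\<bar>" by simp
    ultimately have "1 + norm (v + t *\<^sub>R ?e) \<le> (1 + norm v) * (1 + \<bar>t\<bar>)"
      unfolding distrib_left distrib_right by linarith
    then show ?thesis by (simp add: power_mult_distrib[symmetric] power_mono)
  qed
  have line: "(\<integral>\<omega>'. \<phi> (v + (u \<omega>' $ i) *\<^sub>R ?e) * u \<omega>' $ i \<partial>M) = (\<integral>\<omega>'. G (v + (u \<omega>' $ i) *\<^sub>R ?e) $ i \<partial>M)" for v
  proof -
    have "(\<integral>\<omega>'. \<phi> (v + (u \<omega>' $ i) *\<^sub>R ?e) * u \<omega>' $ i \<partial>M)
        = (\<integral>t. std_normal_density t * (\<phi> (v + t *\<^sub>R ?e) * t) \<partial>lborel)"
      by (rule distributed_integral[OF comp_normal[of i], of "\<lambda>t. \<phi> (v + t *\<^sub>R ?e) * t", symmetric]) auto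
    also have "\<dots> = (\<integral>t. std_normal_density t * G (v + t *\<^sub>R ?e) $ i \<partial>lborel)"
    proof (rule std_normal_stein)
      fix t
      have "((\<lambda>t. v + t *\<^sub>R ?e) has_derivative (\<lambda>t. t *\<^sub>R ?e)) (at t)"
        by (auto intro!: derivative_eq_intros)
      from has_derivative_compose[OF this deriv[of "v + t *\<^sub>R ?e"]]
      show "((\<lambda>t. \<phi> (v + t *\<^sub>R ?e)) has_field_derivative G (v + t *\<^sub>R ?e) $ i) (at t)"
        unfolding has_field_derivative_def by (simp add: inner_axis mult_commute_abs mult.commute)
      show "\<bar>\<phi> (v + t *\<^sub>R ?e)\<bar> \<le> (C * (1 + norm v) ^ p) * (1 + \<bar>t\<bar>) ^ p"
        using order_trans[OF bound mult_left_mono[OF shift C(1)]] by (simp add: mult.assoc)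
      show "\<bar>G (v + t *\<^sub>R ?e) $ i\<bar> \<le> (C' * (1 + norm v) ^ q) * (1 + \<bar>t\<bar>) ^ q"
        using order_trans[OF boundG mult_left_mono[OF shift C(2)]] by (simp add: mult.assoc)
      show "continuous_on UNIV (\<lambda>t. G (v + t *\<^sub>R ?e) $ i)"
        by (intro continuous_on_compose2[OF contG] continuous_intros) auto
    qed
    also have "\<dots> = (\<integral>\<omega>'. G (v + (u \<omega>' $ i) *\<^sub>R ?e) $ i \<partial>M)"
      by (rule distributed_integral[OF comp_normal[of i], of "\<lambda>t. G (v + t *\<^sub>R ?e) $ i"]) auto
    finally show ?thesis .
  qed
  have "expectation (\<lambda>\<omega>. \<phi> (u \<omega>) * u \<omega> $ i) = (\<integral>\<omega>. (\<integral>\<omega>'. \<phi> (?V \<omega> + (u \<omega>' $ i) *\<^sub>R ?e) * u \<omega>' $ i \<partial>M) \<partial>M)"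
    using indep_pair_integral[OF indep_complement_comp[of i], of "\<lambda>(v, t). \<phi> (v + t *\<^sub>R ?e) * t"] int
    by simp
  also have "\<dots> = (\<integral>\<omega>. (\<integral>\<omega>'. G (?V \<omega> + (u \<omega>' $ i) *\<^sub>R ?e) $ i \<partial>M) \<partial>M)"
    by (simp only: line)
  also have "\<dots> = expectation (\<lambda>\<omega>. G (u \<omega>) $ i)"
    using indep_pair_integral[OF indep_complement_comp[of i], of "\<lambda>(v, t). G (v + t *\<^sub>R ?e) $ i"] int'
    by simp
  finally show ?thesis .
qed

section \<open>Moments of a standard Gaussian vector\<close>

lemma integrable_inner_power:
  "integrable M (\<lambda>\<omega>. (a \<bullet> u \<omega>) * (b \<bullet> u \<omega>) * (u \<omega> \<bullet> u \<omega>) ^ p)"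
proof (rule integrable_poly_growth[where C = "norm a * norm b" and p = "2 * p + 2"])
  fix v :: "real^'n"
  have "\<bar>(a \<bullet> v) * (b \<bullet> v) * (v \<bullet> v) ^ p\<bar> \<le> (norm a * norm v) * (norm b * norm v) * (norm v ^ 2) ^ p"
    unfolding abs_mult
    by (intro mult_mono Cauchy_Schwarz_ineq2) (auto simp: power2_norm_eq_inner abs_mult power_abs)
  also have "\<dots> = norm a * norm b * norm v ^ (2 * p + 2)"
    by (simp add: power_mult power_add power2_eq_square)
  also have "\<dots> \<le> norm a * norm b * (1 + norm v) ^ (2 * p + 2)"
    by (intro mult_left_mono power_mono) auto
  finally show "\<bar>(a \<bullet> v) * (b \<bullet> v) * (v \<bullet> v) ^ p\<bar> \<le> norm a * norm b * (1 + norm v) ^ (2 * p + 2)" .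
qed simp

lemma integrable_norm_power: "integrable M (\<lambda>\<omega>. (u \<omega> \<bullet> u \<omega>) ^ p)"
proof (rule integrable_poly_growth[where C = 1 and p = "2 * p"])
  fix v :: "real^'n"
  have "\<bar>(v \<bullet> v) ^ p\<bar> = norm v ^ (2 * p)"
    by (simp add: power_mult power2_norm_eq_inner power_abs)
  then show "\<bar>(v \<bullet> v) ^ p\<bar> \<le> 1 * (1 + norm v) ^ (2 * p)"
    by (simp add: power_mono)
qed simp

text \<open>\<open>stein\<close> for the function
  \<open>(a \<bullet> v) * (v \<bullet> v)^p\<close>, whose gradient is \<open>?G\<close>. For
  \<open>p = 0\<close> the truncated exponent \<open>p - 1\<close> is harmless, since the factor
  \<open>real p\<close> removes that term.\<close>

lemma stein_inner_power_comp:
  "expectation (\<lambda>\<omega>. (a \<bullet> u \<omega>) * u \<omega> $ i * (u \<omega> \<bullet> u \<omega>) ^ p) =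
   a $ i * expectation (\<lambda>\<omega>. (u \<omega> \<bullet> u \<omega>) ^ p) +
   2 * real p * expectation (\<lambda>\<omega>. (a \<bullet> u \<omega>) * u \<omega> $ i * (u \<omega> \<bullet> u \<omega>) ^ (p - 1))"
proof -
  let ?G = "\<lambda>v::real^'n. ((v \<bullet> v) ^ p) *\<^sub>R a + (2 * real p * ((a \<bullet> v) * (v \<bullet> v) ^ (p - 1))) *\<^sub>R v"
  have "expectation (\<lambda>\<omega>. ((a \<bullet> u \<omega>) * (u \<omega> \<bullet> u \<omega>) ^ p) * u \<omega> $ i) = expectation (\<lambda>\<omega>. ?G (u \<omega>) $ i)"
  proof (rule stein)
    fix v :: "real^'n"
    show "((\<lambda>v. (a \<bullet> v) * (v \<bullet> v) ^ p) has_derivative (\<lambda>w. ?G v \<bullet> w)) (at v)"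
      by (auto intro!: derivative_eq_intros
          simp: inner_add_left inner_commute algebra_simps)
    have nrm: "(norm v ^ 2) ^ p \<le> (1 + norm v) ^ (2 * p)"
      by (simp add: power_mult[symmetric] power_mono)
    have "\<bar>(a \<bullet> v) * (v \<bullet> v) ^ p\<bar> \<le> (norm a * norm v) * (norm v ^ 2) ^ p"
      unfolding abs_mult
      by (intro mult_mono Cauchy_Schwarz_ineq2) (auto simp: power2_norm_eq_inner power_abs)
    also have "\<dots> \<le> (norm a * (1 + norm v)) * (1 + norm v) ^ (2 * p)"
      by (intro mult_mono nrm) auto
    finally show "\<bar>(a \<bullet> v) * (v \<bullet> v) ^ p\<bar> \<le> norm a * (1 + norm v) ^ (2 * p + 1)"
      by (simp add: mult_ac)
    have "norm (?G v) \<le> (norm v ^ 2) ^ p * norm a + 2 * real p * (\<bar>a \<bullet> v\<bar> * (norm v ^ 2) ^ (p - 1)) * norm v"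
      by (rule order_trans[OF norm_triangle_ineq])
         (simp add: power2_norm_eq_inner power_abs abs_mult)
    also have "\<dots> \<le> (norm v ^ 2) ^ p * norm a + 2 * real p * ((norm a * norm v) * (norm v ^ 2) ^ (p - 1)) * norm v"
      by (intro add_left_mono mult_right_mono mult_left_mono Cauchy_Schwarz_ineq2) auto
    also have "\<dots> = ((1 + 2 * real p) * norm a) * (norm v ^ 2) ^ p"
      by (cases p) (simp_all add: power2_eq_square algebra_simps)
    also have "\<dots> \<le> ((1 + 2 * real p) * norm a) * (1 + norm v) ^ (2 * p)"
      by (intro mult_left_mono nrm) auto
    finally show "norm (?G v) \<le> ((1 + 2 * real p) * norm a) * (1 + norm v) ^ (2 * p)" .
  qed (intro continuous_intros)
  also have "\<dots> = expectation (\<lambda>\<omega>. a $ i * (u \<omega> \<bullet> u \<omega>) ^ p +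
      2 * real p * ((a \<bullet> u \<omega>) * u \<omega> $ i * (u \<omega> \<bullet> u \<omega>) ^ (p - 1)))"
    by (simp add: mult_ac)
  also have "\<dots> = a $ i * expectation (\<lambda>\<omega>. (u \<omega> \<bullet> u \<omega>) ^ p) +
   2 * real p * expectation (\<lambda>\<omega>. (a \<bullet> u \<omega>) * u \<omega> $ i * (u \<omega> \<bullet> u \<omega>) ^ (p - 1))"
    using integrable_inner_power[of a "axis i 1" "p - 1"] integrable_norm_power[of p]
    by (simp add: inner_axis')
  finally show ?thesis by (simp add: mult_ac)
qed

text \<open>The coordinate identity, contracted with the coordinates of \<open>b\<close>.\<close>

lemma expectation_inner_power:
  "expectation (\<lambda>\<omega>. (a \<bullet> u \<omega>) * (b \<bullet> u \<omega>) * (u \<omega> \<bullet> u \<omega>) ^ p) =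
   (a \<bullet> b) * expectation (\<lambda>\<omega>. (u \<omega> \<bullet> u \<omega>) ^ p) +
   2 * real p * expectation (\<lambda>\<omega>. (a \<bullet> u \<omega>) * (b \<bullet> u \<omega>) * (u \<omega> \<bullet> u \<omega>) ^ (p - 1))"
proof -
  have int: "integrable M (\<lambda>\<omega>. (a \<bullet> u \<omega>) * u \<omega> $ i * (u \<omega> \<bullet> u \<omega>) ^ r)" for i r
    using integrable_inner_power[of a "axis i 1" r] by (simp add: inner_axis')
  have expand: "expectation (\<lambda>\<omega>. (a \<bullet> u \<omega>) * (b \<bullet> u \<omega>) * (u \<omega> \<bullet> u \<omega>) ^ r)
      = (\<Sum>i\<in>UNIV. b $ i * expectation (\<lambda>\<omega>. (a \<bullet> u \<omega>) * u \<omega> $ i * (u \<omega> \<bullet> u \<omega>) ^ r))" for r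
  proof -
    have "(a \<bullet> u \<omega>) * (b \<bullet> u \<omega>) * (u \<omega> \<bullet> u \<omega>) ^ r
        = (\<Sum>i\<in>UNIV. b $ i * ((a \<bullet> u \<omega>) * u \<omega> $ i * (u \<omega> \<bullet> u \<omega>) ^ r))" for \<omega>
    proof -
      have "b \<bullet> u \<omega> = (\<Sum>i\<in>UNIV. b $ i * u \<omega> $ i)" by (simp add: inner_vec_def)
      then show ?thesis by (simp only: sum_distrib_left sum_distrib_right mult_ac)
    qed
    then show ?thesis using int by simp
  qed
  show ?thesis
    unfolding expand stein_inner_power_comp[of a _ p]
    by (simp add: distrib_left sum.distrib sum_distrib_left sum_distrib_right inner_vec_def mult_ac)
qed

lemma expectation_inner_mult_inner: "expectation (\<lambda>\<omega>. (a \<bullet> u \<omega>) * (b \<bullet> u \<omega>)) = a \<bullet> b"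
  using expectation_inner_power[of a b 0] by (simp add: prob_space)

text \<open>Sum \<open>expectation_inner_power\<close> over \<open>a = b = axis i 1\<close>: the
  first terms contribute \<open>n\<close>, and the second ones reassemble the same moment with
  factor \<open>2 * p\<close>. The reassembly needs \<open>p - 1 + 1 = p\<close>, hence the separate
  case \<open>p = 0\<close>.\<close>

lemma expectation_norm_power_Suc:
  "expectation (\<lambda>\<omega>. (u \<omega> \<bullet> u \<omega>) ^ Suc p) =
   (real CARD('n) + 2 * real p) * expectation (\<lambda>\<omega>. (u \<omega> \<bullet> u \<omega>) ^ p)"
proof -
  have expand: "expectation (\<lambda>\<omega>. (u \<omega> \<bullet> u \<omega>) ^ Suc r)
      = (\<Sum>i\<in>UNIV. expectation (\<lambda>\<omega>. (axis i 1 \<bullet> u \<omega>) * (axis i 1 \<bullet> u \<omega>) * (u \<omega> \<bullet> u \<omega>) ^ r))" for r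
  proof -
    have "(u \<omega> \<bullet> u \<omega>) ^ Suc r
        = (\<Sum>i\<in>UNIV. (axis i 1 \<bullet> u \<omega>) * (axis i 1 \<bullet> u \<omega>) * (u \<omega> \<bullet> u \<omega>) ^ r)" for \<omega>
    proof -
      have "u \<omega> \<bullet> u \<omega> = (\<Sum>i\<in>UNIV. (axis i 1 \<bullet> u \<omega>) * (axis i 1 \<bullet> u \<omega>))"
        by (simp add: inner_axis') (simp add: inner_vec_def)
      then show ?thesis by (simp only: power_Suc sum_distrib_right)
    qed
    then show ?thesis
      by (simp only:) (intro Bochner_Integration.integral_sum integrable_inner_power)
  qed
  show ?thesis
  proof (cases p)
    case 0
    then show ?thesis
      unfolding expand using expectation_inner_mult_inner[of "axis i 1" "axis i 1" for i]
      by (simp add: inner_axis' prob_space)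
  next
    case (Suc r)
    show ?thesis
      unfolding expand[of p] expectation_inner_power[of _ _ p]
      using expand[of r] Suc
      by (simp add: sum.distrib sum_distrib_left[symmetric] inner_axis' distrib_right)
  qed
qed

lemma expectation_norm_sq: "expectation (\<lambda>\<omega>. u \<omega> \<bullet> u \<omega>) = real CARD('n)"
  using expectation_norm_power_Suc[of 0] by (simp add: prob_space)

lemma expectation_norm_power_6:
  "expectation (\<lambda>\<omega>. (u \<omega> \<bullet> u \<omega>) ^ 3) = real CARD('n) * (real CARD('n) + 2) * (real CARD('n) + 4)"
  using expectation_norm_power_Suc[of 2] expectation_norm_power_Suc[of 1] expectation_norm_sq
  by (simp add: numeral_3_eq_3 numeral_2_eq_2 algebra_simps)

lemma expectation_inner_sq_norm_sq:
  "expectation (\<lambda>\<omega>. (a \<bullet> u \<omega>)\<^sup>2 * (u \<omega> \<bullet> u \<omega>)) = (real CARD('n) + 2) * (norm a)\<^sup>2"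
  using expectation_inner_power[of a a 1] expectation_norm_sq expectation_inner_mult_inner[of a a]
  unfolding power2_norm_eq_inner by (simp add: power2_eq_square algebra_simps)

lemma integrable_inner: "integrable M (\<lambda>\<omega>. a \<bullet> u \<omega>)"
proof (rule integrable_poly_growth[where C = "norm a" and p = 1])
  fix v :: "real^'n"
  have "\<bar>a \<bullet> v\<bar> \<le> norm a * norm v" by (rule Cauchy_Schwarz_ineq2)
  also have "\<dots> \<le> norm a * (1 + norm v) ^ 1" by (intro mult_left_mono) auto
  finally show "\<bar>a \<bullet> v\<bar> \<le> norm a * (1 + norm v) ^ 1" .
qed simp

lemma expectation_inner: "expectation (\<lambda>\<omega>. a \<bullet> u \<omega>) = 0"
proof -
  have "integrable M (\<lambda>\<omega>. u \<omega> $ i)" for i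
    using integrable_inner[of "axis i 1"] by (simp add: inner_axis')
  moreover have "expectation (\<lambda>\<omega>. u \<omega> $ i) = 0" for i
    using standard_normal_distributed_expectation[OF comp_normal] .
  ultimately show ?thesis by (simp add: inner_vec_def)
qed

end

subsection \<open>Gaussian smoothing\<close>

lemma power_one_plus_norm_mono:
  fixes v :: "'a::real_normed_vector"
  assumes "r \<le> q"
  shows "norm v ^ r \<le> (1 + norm v) ^ q"
proof -
  have "norm v ^ r \<le> (1 + norm v) ^ r" by (intro power_mono) auto
  also have "\<dots> \<le> (1 + norm v) ^ q" using assms by (intro power_increasing) auto
  finally show ?thesis .
qed

locale smoothed_objective = standard_gaussian_vector M u + lipschitz_gradient f g L
  for M :: "'a measure" and u :: "'a \<Rightarrow> real^'n"
    and f :: "real^'n \<Rightarrow> real" and g L +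
  fixes \<mu> :: real and xs :: "real^'n"
  assumes convex: "convex_on UNIV f"
    and minimizer: "\<And>x. f xs \<le> f x"
    and \<mu>_pos: "\<mu> > 0"
begin

lemma [measurable]: "f \<in> borel_measurable borel" "g \<in> borel_measurable borel"
  using continuous continuous_gradient by (auto intro: borel_measurable_continuous_onI)

lemma lower: "f x + g x \<bullet> (y - x) \<le> f y"
  by (rule convex_on_gradient_lower_bound[OF convex grad])

lemma gradient_minimizer: "g xs = 0"
  using norm_gradient_sq_le[OF minimizer, of xs] by simp

lemma minimizer_quadratic_bound: "f x - f xs \<le> L / 2 * (norm (x - xs))\<^sup>2"
  using descent[of x xs] by (simp add: gradient_minimizer)

text \<open>Convexity bounds the first-order remainder from below, the descent estimate from
  above.\<close>

lemma taylor_remainder: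
  "0 \<le> f (x + \<mu> *\<^sub>R v) - f x - \<mu> * (g x \<bullet> v)"
  "f (x + \<mu> *\<^sub>R v) - f x - \<mu> * (g x \<bullet> v) \<le> L / 2 * \<mu>\<^sup>2 * (v \<bullet> v)"
  using lower[of x "x + \<mu> *\<^sub>R v"] descent[of "x + \<mu> *\<^sub>R v" x]
  by (simp_all add: power_mult_distrib power2_norm_eq_inner)

section \<open>Polynomial growth and integrability of increments\<close>

lemma increment_growth:
  "\<bar>f (x + \<mu> *\<^sub>R v) - f x\<bar> \<le> (\<mu> * norm (g x) + L / 2 * \<mu>\<^sup>2) * (1 + norm v) ^ 2"
proof -
  have "\<bar>g x \<bullet> v\<bar> \<le> norm (g x) * norm v" by (rule Cauchy_Schwarz_ineq2)
  also have "\<dots> \<le> norm (g x) * (1 + norm v) ^ 2"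
    using power_one_plus_norm_mono[of 1 2 v] by (intro mult_left_mono) auto
  finally have "\<bar>\<mu> * (g x \<bullet> v)\<bar> \<le> \<mu> * (norm (g x) * (1 + norm v) ^ 2)"
    using \<mu>_pos by (simp add: abs_mult)
  moreover have "L / 2 * \<mu>\<^sup>2 * (v \<bullet> v) \<le> L / 2 * \<mu>\<^sup>2 * (1 + norm v) ^ 2"
    using power_one_plus_norm_mono[of 2 2 v] L_pos
    by (intro mult_left_mono) (auto simp: power2_norm_eq_inner)
  ultimately show ?thesis
    using taylor_remainder[of x v] unfolding distrib_right mult.assoc by linarith
qed

lemma gradient_growth: "norm (g (x + \<mu> *\<^sub>R v)) \<le> (norm (g x) + L * \<mu>) * (1 + norm v) ^ 1"
proof -
  have "norm (g (x + \<mu> *\<^sub>R v)) \<le> norm (g x) + norm (g (x + \<mu> *\<^sub>R v) - g x)"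
    by (metis add.commute diff_add_cancel norm_triangle_ineq)
  also have "\<dots> \<le> norm (g x) + L * \<mu> * norm v"
    using lip[of "x + \<mu> *\<^sub>R v" x] \<mu>_pos by (simp add: mult.assoc)
  also have "\<dots> \<le> (norm (g x) + L * \<mu>) * (1 + norm v) ^ 1"
    using L_pos \<mu>_pos by (simp add: algebra_simps)
  finally show ?thesis .
qed

lemma integrable_f_shift: "integrable M (\<lambda>\<omega>. f (x + \<mu> *\<^sub>R u \<omega>))"
proof -
  have "integrable M (\<lambda>\<omega>. f (x + \<mu> *\<^sub>R u \<omega>) - f x)"
    by (rule integrable_poly_growth[OF _ increment_growth]) simp
  from Bochner_Integration.integrable_add[OF this, of "\<lambda>_. f x"] show ?thesis by simp
qed

lemma integrable_increment_inner:
  "integrable M (\<lambda>\<omega>. (f (x + \<mu> *\<^sub>R u \<omega>) - f x) * (d \<bullet> u \<omega>))"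
proof (rule integrable_poly_growth)
  fix v :: "real^'n"
  let ?C = "\<mu> * norm (g x) + L / 2 * \<mu>\<^sup>2"
  have "\<bar>d \<bullet> v\<bar> \<le> norm d * (1 + norm v)"
    by (rule order_trans[OF Cauchy_Schwarz_ineq2]) (simp add: mult_left_mono)
  then have "\<bar>(f (x + \<mu> *\<^sub>R v) - f x) * (d \<bullet> v)\<bar> \<le> (?C * (1 + norm v) ^ 2) * (norm d * (1 + norm v))"
    unfolding abs_mult using L_pos \<mu>_pos by (intro mult_mono increment_growth) auto
  then show "\<bar>(f (x + \<mu> *\<^sub>R v) - f x) * (d \<bullet> v)\<bar> \<le> (?C * norm d) * (1 + norm v) ^ 3"
    by (simp add: power_Suc numeral_3_eq_3 numeral_2_eq_2 mult_ac)
qed simp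

lemma integrable_increment_norm:
  "integrable M (\<lambda>\<omega>. (f (x + \<mu> *\<^sub>R u \<omega>) - f x) * (u \<omega> \<bullet> u \<omega>))"
proof (rule integrable_poly_growth)
  fix v :: "real^'n"
  let ?C = "\<mu> * norm (g x) + L / 2 * \<mu>\<^sup>2"
  have "\<bar>(f (x + \<mu> *\<^sub>R v) - f x) * (v \<bullet> v)\<bar> \<le> (?C * (1 + norm v) ^ 2) * (1 + norm v) ^ 2"
    unfolding abs_mult using L_pos \<mu>_pos power_one_plus_norm_mono[of 2 2 v]
    by (intro mult_mono increment_growth) (auto simp: power2_norm_eq_inner)
  then show "\<bar>(f (x + \<mu> *\<^sub>R v) - f x) * (v \<bullet> v)\<bar> \<le> ?C * (1 + norm v) ^ 4"
    by (simp add: power_add[symmetric] mult.assoc)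
qed simp

lemma integrable_increment_sq_norm:
  "integrable M (\<lambda>\<omega>. (f (x + \<mu> *\<^sub>R u \<omega>) - f x)\<^sup>2 * (u \<omega> \<bullet> u \<omega>))"
proof (rule integrable_poly_growth)
  fix v :: "real^'n"
  let ?C = "\<mu> * norm (g x) + L / 2 * \<mu>\<^sup>2"
  have "(f (x + \<mu> *\<^sub>R v) - f x)\<^sup>2 \<le> (?C * (1 + norm v) ^ 2)\<^sup>2"
    using power_mono[OF increment_growth, of x v 2] by simp
  then have "\<bar>(f (x + \<mu> *\<^sub>R v) - f x)\<^sup>2 * (v \<bullet> v)\<bar> \<le> (?C * (1 + norm v) ^ 2)\<^sup>2 * (1 + norm v) ^ 2"
    unfolding abs_mult using power_one_plus_norm_mono[of 2 2 v]
    by (intro mult_mono) (auto simp: power2_norm_eq_inner)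
  then show "\<bar>(f (x + \<mu> *\<^sub>R v) - f x)\<^sup>2 * (v \<bullet> v)\<bar> \<le> ?C\<^sup>2 * (1 + norm v) ^ 6"
    by (simp add: power_mult_distrib power_add[symmetric] power_mult[symmetric] mult.assoc)
qed simp

lemma integrable_gradient_inner: "integrable M (\<lambda>\<omega>. g (x + \<mu> *\<^sub>R u \<omega>) \<bullet> d)"
proof (rule integrable_poly_growth)
  fix v :: "real^'n"
  have "\<bar>g (x + \<mu> *\<^sub>R v) \<bullet> d\<bar> \<le> ((norm (g x) + L * \<mu>) * (1 + norm v) ^ 1) * norm d"
    by (rule order_trans[OF Cauchy_Schwarz_ineq2]) (intro mult_right_mono gradient_growth norm_ge_zero)
  then show "\<bar>g (x + \<mu> *\<^sub>R v) \<bullet> d\<bar> \<le> ((norm (g x) + L * \<mu>) * norm d) * (1 + norm v) ^ 1"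
    by (simp add: mult_ac)
qed simp

text \<open>As a function of \<open>v\<close>, the increment \<open>f (x + \<mu> v) - f x\<close>
  has gradient \<open>\<mu> g (x + \<mu> v)\<close>; \<open>stein\<close> is applied in each
  coordinate and contracted with \<open>d\<close>.\<close>

lemma expectation_increment_inner:
  "expectation (\<lambda>\<omega>. (f (x + \<mu> *\<^sub>R u \<omega>) - f x) * (d \<bullet> u \<omega>)) = \<mu> * expectation (\<lambda>\<omega>. g (x + \<mu> *\<^sub>R u \<omega>) \<bullet> d)"
proof -
  have comp: "expectation (\<lambda>\<omega>. (f (x + \<mu> *\<^sub>R u \<omega>) - f x) * u \<omega> $ i)
      = expectation (\<lambda>\<omega>. (\<mu> *\<^sub>R g (x + \<mu> *\<^sub>R u \<omega>)) $ i)" for i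
  proof (rule stein[where G = "\<lambda>v. \<mu> *\<^sub>R g (x + \<mu> *\<^sub>R v)", OF _ _ increment_growth])
    fix v :: "real^'n"
    have "((\<lambda>v. x + \<mu> *\<^sub>R v) has_derivative (\<lambda>w. \<mu> *\<^sub>R w)) (at v)"
      by (auto intro!: derivative_eq_intros)
    from has_derivative_compose[OF this grad]
    have "((\<lambda>v. f (x + \<mu> *\<^sub>R v)) has_derivative (\<lambda>w. g (x + \<mu> *\<^sub>R v) \<bullet> (\<mu> *\<^sub>R w))) (at v)" .
    from has_derivative_diff[OF this has_derivative_const[of "f x"]]
    show "((\<lambda>v. f (x + \<mu> *\<^sub>R v) - f x) has_derivative (\<lambda>w. (\<mu> *\<^sub>R g (x + \<mu> *\<^sub>R v)) \<bullet> w)) (at v)"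
      by simp
    show "norm (\<mu> *\<^sub>R g (x + \<mu> *\<^sub>R v)) \<le> (\<mu> * (norm (g x) + L * \<mu>)) * (1 + norm v) ^ 1"
      using mult_left_mono[OF gradient_growth, of \<mu> x v] \<mu>_pos by (simp add: mult.assoc)
  next
    show "continuous_on UNIV (\<lambda>v. \<mu> *\<^sub>R g (x + \<mu> *\<^sub>R v))"
      by (intro continuous_intros continuous_on_compose2[OF continuous_gradient]) auto
  qed
  have int: "integrable M (\<lambda>\<omega>. (f (x + \<mu> *\<^sub>R u \<omega>) - f x) * u \<omega> $ i)" for i
    using integrable_increment_inner[of x "axis i 1"] by (simp add: inner_axis')
  have int': "integrable M (\<lambda>\<omega>. g (x + \<mu> *\<^sub>R u \<omega>) $ i)" for i
    using integrable_gradient_inner[of x "axis i 1"] by (simp add: inner_axis)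
  have "expectation (\<lambda>\<omega>. (f (x + \<mu> *\<^sub>R u \<omega>) - f x) * (d \<bullet> u \<omega>))
      = expectation (\<lambda>\<omega>. \<Sum>i\<in>UNIV. d $ i * ((f (x + \<mu> *\<^sub>R u \<omega>) - f x) * u \<omega> $ i))"
    by (simp add: inner_vec_def[of d] sum_distrib_left mult_ac)
  also have "\<dots> = (\<Sum>i\<in>UNIV. d $ i * expectation (\<lambda>\<omega>. (f (x + \<mu> *\<^sub>R u \<omega>) - f x) * u \<omega> $ i))"
    using int by simp
  also have "\<dots> = (\<Sum>i\<in>UNIV. \<mu> * (d $ i * expectation (\<lambda>\<omega>. g (x + \<mu> *\<^sub>R u \<omega>) $ i)))"
    unfolding comp by (simp add: mult_ac)
  also have "\<dots> = \<mu> * expectation (\<lambda>\<omega>. \<Sum>i\<in>UNIV. d $ i * g (x + \<mu> *\<^sub>R u \<omega>) $ i)"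
    using int' by (simp add: sum_distrib_left)
  also have "(\<lambda>\<omega>. \<Sum>i\<in>UNIV. d $ i * g (x + \<mu> *\<^sub>R u \<omega>) $ i) = (\<lambda>\<omega>. g (x + \<mu> *\<^sub>R u \<omega>) \<bullet> d)"
    by (simp add: inner_vec_def mult_ac)
  finally show ?thesis .
qed

text \<open>Smoothing does not lower \<open>f\<close> at \<open>x\<close>, because the linear term
  has mean zero. At \<open>xs\<close> it raises \<open>f\<close> by at most
  \<open>\<mu>^2 * L * n / 2\<close>, because the gradient vanishes there. So the whole error arises
  at the minimizer.\<close>

lemma expectation_increment_inner_ge:
  "expectation (\<lambda>\<omega>. (f (x + \<mu> *\<^sub>R u \<omega>) - f x) * ((x - xs) \<bullet> u \<omega>))
    \<ge> \<mu> * (f x - f xs - \<mu>\<^sup>2 * L * real CARD('n) / 2)"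
proof -
  have "f x = expectation (\<lambda>\<omega>. f x + \<mu> * (g x \<bullet> u \<omega>))"
    using integrable_inner[of "g x"] expectation_inner[of "g x"] by (simp add: prob_space)
  also have "\<dots> \<le> expectation (\<lambda>\<omega>. f (x + \<mu> *\<^sub>R u \<omega>))"
    using taylor_remainder(1)[of x] integrable_inner[of "g x"] integrable_f_shift[of x]
    by (intro integral_mono) (auto simp: algebra_simps)
  finally have 1: "f x \<le> expectation (\<lambda>\<omega>. f (x + \<mu> *\<^sub>R u \<omega>))" .
  have intn: "integrable M (\<lambda>\<omega>. u \<omega> \<bullet> u \<omega>)" using integrable_norm_power[of 1] by simp
  have "expectation (\<lambda>\<omega>. f (xs + \<mu> *\<^sub>R u \<omega>)) \<le> expectation (\<lambda>\<omega>. f xs + L / 2 * \<mu>\<^sup>2 * (u \<omega> \<bullet> u \<omega>))"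
  proof (rule integral_mono)
    show "f (xs + \<mu> *\<^sub>R u \<omega>) \<le> f xs + L / 2 * \<mu>\<^sup>2 * (u \<omega> \<bullet> u \<omega>)" for \<omega>
      using taylor_remainder(2)[of xs "u \<omega>"] by (simp add: gradient_minimizer)
  qed (use integrable_f_shift intn in auto)
  also have "\<dots> = f xs + \<mu>\<^sup>2 * L * real CARD('n) / 2"
    using intn by (simp add: expectation_norm_sq prob_space)
  finally have 2: "expectation (\<lambda>\<omega>. f (xs + \<mu> *\<^sub>R u \<omega>)) \<le> f xs + \<mu>\<^sup>2 * L * real CARD('n) / 2" .
  \<comment> \<open>Both points are shifted by the same \<open>\<mu> v\<close>, so the direction
    stays \<open>x - xs\<close> and does not depend on \<open>v\<close>.\<close>
  have "f (x + \<mu> *\<^sub>R v) - f (xs + \<mu> *\<^sub>R v) \<le> g (x + \<mu> *\<^sub>R v) \<bullet> (x - xs)" for v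
    using lower[of "x + \<mu> *\<^sub>R v" "xs + \<mu> *\<^sub>R v"] by (simp add: inner_diff_right)
  then have "expectation (\<lambda>\<omega>. f (x + \<mu> *\<^sub>R u \<omega>) - f (xs + \<mu> *\<^sub>R u \<omega>)) \<le> expectation (\<lambda>\<omega>. g (x + \<mu> *\<^sub>R u \<omega>) \<bullet> (x - xs))"
    by (intro integral_mono Bochner_Integration.integrable_diff integrable_f_shift integrable_gradient_inner)
  then have "f x - f xs - \<mu>\<^sup>2 * L * real CARD('n) / 2 \<le> expectation (\<lambda>\<omega>. g (x + \<mu> *\<^sub>R u \<omega>) \<bullet> (x - xs))"
    using 1 2 integrable_f_shift by simp
  then show ?thesis
    unfolding expectation_increment_inner using \<mu>_pos by (intro mult_left_mono) auto
qed

text \<open>The increment is its linear part plus a remainder \<open>R\<close> of second order in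
  \<open>\<mu>\<close>. With \<open>(a + b)^2 \<le> 2 a^2 + 2 b^2\<close>, the remainder calls for
  the sixth moment of the norm and the linear part for the mixed fourth moment.\<close>

lemma expectation_increment_sq_norm_le:
  "expectation (\<lambda>\<omega>. (f (x + \<mu> *\<^sub>R u \<omega>) - f x)\<^sup>2 * (u \<omega> \<bullet> u \<omega>))
    \<le> \<mu>\<^sup>2 * (\<mu>\<^sup>2 * L\<^sup>2 / 2 * (real CARD('n) * (real CARD('n) + 2) * (real CARD('n) + 4))
        + 2 * (real CARD('n) + 2) * (norm (g x))\<^sup>2)"
proof -
  have int1: "integrable M (\<lambda>\<omega>. (g x \<bullet> u \<omega>)\<^sup>2 * (u \<omega> \<bullet> u \<omega>))"
    using integrable_inner_power[of "g x" "g x" 1] by (simp add: power2_eq_square)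
  have int2: "integrable M (\<lambda>\<omega>. (u \<omega> \<bullet> u \<omega>) ^ 3)" by (rule integrable_norm_power)
  have le: "(f (x + \<mu> *\<^sub>R v) - f x)\<^sup>2 * (v \<bullet> v)
      \<le> \<mu> ^ 4 * L\<^sup>2 / 2 * (v \<bullet> v) ^ 3 + 2 * \<mu>\<^sup>2 * ((g x \<bullet> v)\<^sup>2 * (v \<bullet> v))" for v
  proof -
    define R where "R = f (x + \<mu> *\<^sub>R v) - f x - \<mu> * (g x \<bullet> v)"
    have "R\<^sup>2 \<le> (L / 2 * \<mu>\<^sup>2 * (v \<bullet> v))\<^sup>2"
      using taylor_remainder[of x v] unfolding R_def by (intro power_mono)
    moreover have "(f (x + \<mu> *\<^sub>R v) - f x)\<^sup>2 \<le> 2 * R\<^sup>2 + 2 * (\<mu> * (g x \<bullet> v))\<^sup>2"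
    proof -
      have "f (x + \<mu> *\<^sub>R v) - f x = R + \<mu> * (g x \<bullet> v)" by (simp add: R_def)
      moreover have "(a + b)\<^sup>2 \<le> 2 * a\<^sup>2 + 2 * b\<^sup>2" for a b :: real
        using zero_le_power2[of "a - b"] unfolding power2_sum power2_diff by linarith
      ultimately show ?thesis by metis
    qed
    ultimately have "(f (x + \<mu> *\<^sub>R v) - f x)\<^sup>2 \<le> 2 * (L / 2 * \<mu>\<^sup>2 * (v \<bullet> v))\<^sup>2 + 2 * (\<mu> * (g x \<bullet> v))\<^sup>2"
      by linarith
    then have "(f (x + \<mu> *\<^sub>R v) - f x)\<^sup>2 * (v \<bullet> v)
        \<le> (2 * (L / 2 * \<mu>\<^sup>2 * (v \<bullet> v))\<^sup>2 + 2 * (\<mu> * (g x \<bullet> v))\<^sup>2) * (v \<bullet> v)"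
      by (intro mult_right_mono) auto
    also have "\<dots> = \<mu> ^ 4 * L\<^sup>2 / 2 * (v \<bullet> v) ^ 3 + 2 * \<mu>\<^sup>2 * ((g x \<bullet> v)\<^sup>2 * (v \<bullet> v))"
      by (simp add: power2_eq_square numeral_3_eq_3 power4_eq_xxxx field_simps)
    finally show ?thesis .
  qed
  have "expectation (\<lambda>\<omega>. (f (x + \<mu> *\<^sub>R u \<omega>) - f x)\<^sup>2 * (u \<omega> \<bullet> u \<omega>))
    \<le> expectation (\<lambda>\<omega>. \<mu> ^ 4 * L\<^sup>2 / 2 * (u \<omega> \<bullet> u \<omega>) ^ 3 + 2 * \<mu>\<^sup>2 * ((g x \<bullet> u \<omega>)\<^sup>2 * (u \<omega> \<bullet> u \<omega>)))"
    using int1 int2 by (intro integral_mono integrable_increment_sq_norm le) auto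
  also have "\<dots> = \<mu> ^ 4 * L\<^sup>2 / 2 * (real CARD('n) * (real CARD('n) + 2) * (real CARD('n) + 4))
      + 2 * \<mu>\<^sup>2 * ((real CARD('n) + 2) * (norm (g x))\<^sup>2)"
    using int1 int2 by (simp add: expectation_norm_power_6 expectation_inner_sq_norm_sq)
  also have "\<dots> = \<mu>\<^sup>2 * (\<mu>\<^sup>2 * L\<^sup>2 / 2 * (real CARD('n) * (real CARD('n) + 2) * (real CARD('n) + 4))
        + 2 * (real CARD('n) + 2) * (norm (g x))\<^sup>2)"
    by (simp add: power2_eq_square power4_eq_xxxx algebra_simps)
  finally show ?thesis .
qed

text \<open>In the expanded square, terms linear in \<open>W\<close> have mean zero by independence
  from \<open>u\<close>. The noise thus enters only through its second moment \<open>s\<close>,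
  weighted by \<open>n\<close>, the mean of \<open>u \<bullet> u\<close>.\<close>

lemma noisy_step:
  fixes x :: "real^'n" and W :: "'a \<Rightarrow> real"
  assumes indep: "indep_pair borel u borel W"
    and W2: "integrable M (\<lambda>\<omega>. (W \<omega>)\<^sup>2)" "expectation (\<lambda>\<omega>. (W \<omega>)\<^sup>2) = s"
    and EW: "expectation W = 0"
    and h: "h > 0"
  defines "x' \<equiv> \<lambda>\<omega>. x - (h * ((f (x + \<mu> *\<^sub>R u \<omega>) - f x + W \<omega>) / \<mu>)) *\<^sub>R u \<omega>"
  shows "integrable M (\<lambda>\<omega>. (norm (x' \<omega> - xs))\<^sup>2)"
    and "expectation (\<lambda>\<omega>. (norm (x' \<omega> - xs))\<^sup>2) \<le> (norm (x - xs))\<^sup>2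
      - 2 * h * (f x - f xs - \<mu>\<^sup>2 * L * real CARD('n) / 2)
      + h\<^sup>2 * (\<mu>\<^sup>2 * L\<^sup>2 / 2 * (real CARD('n) * (real CARD('n) + 2) * (real CARD('n) + 4))
        + 2 * (real CARD('n) + 2) * (norm (g x))\<^sup>2 + s * real CARD('n) / \<mu>\<^sup>2)"
proof -
  define d where "d = x - xs"
  define \<Delta> where "\<Delta> v = f (x + \<mu> *\<^sub>R v) - f x" for v
  have [measurable]: "W \<in> borel_measurable M" "\<Delta> \<in> borel_measurable borel"
    using indep unfolding indep_pair_def \<Delta>_def by auto
  have W: "integrable M W"
    by (rule square_integrable_imp_integrable) (use W2 in auto)
  note i1 = integrable_increment_inner[of x d, folded \<Delta>_def]
  note i2 = integrable_increment_norm[of x, folded \<Delta>_def]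
  note i3 = integrable_increment_sq_norm[of x, folded \<Delta>_def]
  have i4: "integrable M (\<lambda>\<omega>. u \<omega> \<bullet> u \<omega>)" using integrable_norm_power[of 1] by simp
  note mult_integrable = indep_pair_mult_integrable[OF indep]
    and expectation_mult = indep_pair_expectation_mult[OF indep]
  have p1: "integrable M (\<lambda>\<omega>. (d \<bullet> u \<omega>) * W \<omega>)"
    by (rule mult_integrable[where p = "\<lambda>v. d \<bullet> v" and q = "\<lambda>w. w"]) (simp_all add: integrable_inner W)
  have e1: "expectation (\<lambda>\<omega>. (d \<bullet> u \<omega>) * W \<omega>) = 0"
    by (subst expectation_mult[where p = "\<lambda>v. d \<bullet> v" and q = "\<lambda>w. w"]) (simp_all add: integrable_inner W EW)
  have p2: "integrable M (\<lambda>\<omega>. \<Delta> (u \<omega>) * (u \<omega> \<bullet> u \<omega>) * W \<omega>)"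
    by (rule mult_integrable[where p = "\<lambda>v. \<Delta> v * (v \<bullet> v)" and q = "\<lambda>w. w"]) (simp_all add: i2 W)
  have e2: "expectation (\<lambda>\<omega>. \<Delta> (u \<omega>) * (u \<omega> \<bullet> u \<omega>) * W \<omega>) = 0"
    by (subst expectation_mult[where p = "\<lambda>v. \<Delta> v * (v \<bullet> v)" and q = "\<lambda>w. w"]) (simp_all add: i2 W EW)
  have p3: "integrable M (\<lambda>\<omega>. (u \<omega> \<bullet> u \<omega>) * (W \<omega>)\<^sup>2)"
    by (rule mult_integrable[where p = "\<lambda>v. v \<bullet> v" and q = "\<lambda>w. w\<^sup>2"]) (simp_all add: i4 W2)
  have e3: "expectation (\<lambda>\<omega>. (u \<omega> \<bullet> u \<omega>) * (W \<omega>)\<^sup>2) = real CARD('n) * s"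
    by (subst expectation_mult[where p = "\<lambda>v. v \<bullet> v" and q = "\<lambda>w. w\<^sup>2"]) (simp_all add: i4 W2 expectation_norm_sq)
  \<comment> \<open>Arranged so that each random term either is free of \<open>W\<close> or is a
    function of \<open>u\<close> times \<open>W\<close> or its square.\<close>
  have eq: "(norm (x' \<omega> - xs))\<^sup>2 = (norm d)\<^sup>2
      - 2 * (h / \<mu>) * (\<Delta> (u \<omega>) * (d \<bullet> u \<omega>) + (d \<bullet> u \<omega>) * W \<omega>)
      + (h / \<mu>)\<^sup>2 * ((\<Delta> (u \<omega>))\<^sup>2 * (u \<omega> \<bullet> u \<omega>) + 2 * (\<Delta> (u \<omega>) * (u \<omega> \<bullet> u \<omega>) * W \<omega>)
          + (u \<omega> \<bullet> u \<omega>) * (W \<omega>)\<^sup>2)" for \<omega>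
  proof -
    define t where "t = (h / \<mu>) * (\<Delta> (u \<omega>) + W \<omega>)"
    have x': "x' \<omega> - xs = d - t *\<^sub>R u \<omega>"
      by (simp add: x'_def d_def t_def \<Delta>_def)
    have "(norm (x' \<omega> - xs))\<^sup>2 = (norm d)\<^sup>2 - 2 * t * (d \<bullet> u \<omega>) + t\<^sup>2 * (u \<omega> \<bullet> u \<omega>)"
      unfolding x' power2_norm_eq_inner
      by (simp add: inner_diff_left inner_diff_right inner_commute power2_eq_square algebra_simps)
    then show ?thesis
      unfolding t_def power_mult_distrib power2_sum by (simp add: algebra_simps)
  qed
  show "integrable M (\<lambda>\<omega>. (norm (x' \<omega> - xs))\<^sup>2)"
    unfolding eq using i1 i3 p1 p2 p3 by simp
  have "expectation (\<lambda>\<omega>. (norm (x' \<omega> - xs))\<^sup>2) = (norm d)\<^sup>2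
      - 2 * (h / \<mu>) * expectation (\<lambda>\<omega>. \<Delta> (u \<omega>) * (d \<bullet> u \<omega>))
      + (h / \<mu>)\<^sup>2 * (expectation (\<lambda>\<omega>. (\<Delta> (u \<omega>))\<^sup>2 * (u \<omega> \<bullet> u \<omega>)) + real CARD('n) * s)"
    unfolding eq using i1 i3 p1 p2 p3
    by (simp add: prob_space e1 e2 e3)
  also have "\<dots> \<le> (norm d)\<^sup>2
      - 2 * (h / \<mu>) * (\<mu> * (f x - f xs - \<mu>\<^sup>2 * L * real CARD('n) / 2))
      + (h / \<mu>)\<^sup>2 * (\<mu>\<^sup>2 * (\<mu>\<^sup>2 * L\<^sup>2 / 2 * (real CARD('n) * (real CARD('n) + 2) * (real CARD('n) + 4))
        + 2 * (real CARD('n) + 2) * (norm (g x))\<^sup>2) + real CARD('n) * s)"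
    unfolding d_def \<Delta>_def using h \<mu>_pos
    by (intro add_mono diff_mono mult_left_mono expectation_increment_inner_ge
        expectation_increment_sq_norm_le order_refl) auto
  also have "\<dots> = (norm (x - xs))\<^sup>2
      - 2 * h * (f x - f xs - \<mu>\<^sup>2 * L * real CARD('n) / 2)
      + h\<^sup>2 * (\<mu>\<^sup>2 * L\<^sup>2 / 2 * (real CARD('n) * (real CARD('n) + 2) * (real CARD('n) + 4))
        + 2 * (real CARD('n) + 2) * (norm (g x))\<^sup>2 + s * real CARD('n) / \<mu>\<^sup>2)"
    using \<mu>_pos by (simp add: d_def power_divide field_simps)
  finally show "expectation (\<lambda>\<omega>. (norm (x' \<omega> - xs))\<^sup>2) \<le> \<dots>" .
qed

end

section \<open>Numerical bound on the error constant, and telescoping\<close>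

lemma step_constant_bound:
  fixes n L \<sigma> \<mu> h :: real
  assumes n: "n \<ge> 0" and L: "L > 0" and \<sigma>: "\<sigma> > 0" and \<mu>: "\<mu> > 0"
    and \<mu>4: "\<mu> ^ 4 = 8 * \<sigma>\<^sup>2 * n / (L\<^sup>2 * (n + 6) ^ 3)"
    and h: "h = 1 / (4 * L * (n + 4))"
  shows "\<mu>\<^sup>2 * L * n + h * (\<mu>\<^sup>2 * L\<^sup>2 / 2 * (n * (n + 2) * (n + 4)) + 2 * \<sigma>\<^sup>2 * n / \<mu>\<^sup>2)
    \<le> 3 * sqrt 2 / 5 * \<sigma> * (n + 4)" (is "?c \<le> _")
proof -
  \<comment> \<open>Only the fourth power of \<open>\<mu>\<close> is rational in the data. The noise
    term is therefore rewritten so that the whole left side is linear in \<open>q\<close>, and both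
    sides are squared, which brings in \<open>q^2\<close>.\<close>
  define q where "q = \<mu>\<^sup>2 * L"
  \<comment> \<open>\<open>P\<close> is
    \<open>16 n (n + 4) + 2 n (n + 2) (n + 4) + (n + 6)^3\<close>: smoothing bias, curvature and
    noise over the common denominator \<open>16 (n + 4)\<close>.\<close>
  define P where "P = 3 * n ^ 3 + 46 * n\<^sup>2 + 188 * n + 216"
  have q: "q > 0" using L \<mu> by (simp add: q_def)
  have q2: "q\<^sup>2 * (n + 6) ^ 3 = 8 * \<sigma>\<^sup>2 * n"
  proof -
    have "q\<^sup>2 = \<mu> ^ 4 * L\<^sup>2" by (simp add: q_def power_mult_distrib flip: power_mult)
    then show ?thesis using n L by (simp add: \<mu>4 field_simps)
  qed
  have noise: "2 * \<sigma>\<^sup>2 * n / \<mu>\<^sup>2 = q * L * (n + 6) ^ 3 / 4"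
  proof -
    have "2 * \<sigma>\<^sup>2 * n / \<mu>\<^sup>2 = (q\<^sup>2 * (n + 6) ^ 3) * L / (4 * q)"
      unfolding q2 using L \<mu> by (simp add: q_def field_simps)
    then show ?thesis using q by (simp add: power2_eq_square)
  qed
  have c: "?c = q * P / (16 * (n + 4))"
  proof -
    have hL: "h * L = 1 / (4 * (n + 4))" using L by (simp add: h)
    have "?c = q * n + (h * L) * (q * (n * (n + 2) * (n + 4) / 2 + (n + 6) ^ 3 / 4))"
      unfolding noise by (simp add: q_def power2_eq_square algebra_simps)
    also have "\<dots> = q * P / (16 * (n + 4))"
      unfolding hL P_def using n by (simp add: field_simps power2_eq_square power3_eq_cube)
    finally show ?thesis .
  qed
  have "?c\<^sup>2 \<le> (3 * sqrt 2 / 5 * \<sigma> * (n + 4))\<^sup>2"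
  proof -
    \<comment> \<open>The squared claim after eliminating \<open>q^2\<close>:
      \<open>(3 * sqrt 2 / 5)^2 = 18 / 25\<close>, and \<open>576 = 256 * 18 / 8\<close>. The
      difference of the two sides expands to a polynomial in \<open>n\<close> with positive
      coefficients only.\<close>
    have "25 * n * P\<^sup>2 \<le> 576 * ((n + 4) ^ 4 * (n + 6) ^ 3)"
    proof -
      have "576 * ((n + 4) ^ 4 * (n + 6) ^ 3) - 25 * n * P\<^sup>2
        = 351 * n ^ 7 + 12684 * n ^ 6 + 202292 * n ^ 5 + 1797728 * n ^ 4 + 9383888 * n ^ 3
          + 28492992 * n\<^sup>2 + 46609344 * n + 31850496"
        unfolding P_def by algebra
      moreover have "\<dots> \<ge> 0" using n by simp
      ultimately show ?thesis by linarith
    qed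
    then have "(8 * \<sigma>\<^sup>2) * (25 * n * P\<^sup>2) \<le> (8 * \<sigma>\<^sup>2) * (576 * ((n + 4) ^ 4 * (n + 6) ^ 3))"
      by (intro mult_left_mono) auto
    also have "(8 * \<sigma>\<^sup>2) * (25 * n * P\<^sup>2) = (25 * q\<^sup>2 * P\<^sup>2) * (n + 6) ^ 3"
      using q2 by algebra
    finally have "(25 * q\<^sup>2 * P\<^sup>2) * (n + 6) ^ 3 \<le> (4608 * \<sigma>\<^sup>2 * (n + 4) ^ 4) * (n + 6) ^ 3"
      by (simp add: mult_ac)
    then have "25 * q\<^sup>2 * P\<^sup>2 \<le> 4608 * \<sigma>\<^sup>2 * (n + 4) ^ 4"
      by (rule mult_right_le_imp_le) (use n in simp)
    then have "q\<^sup>2 * P\<^sup>2 / (256 * (n + 4)\<^sup>2) \<le> 18 / 25 * \<sigma>\<^sup>2 * (n + 4)\<^sup>2"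
      using n by (simp add: field_simps flip: power_add)
    then show ?thesis
      unfolding c power_divide power_mult_distrib by simp
  qed
  then show ?thesis
    by (rule power2_le_imp_le) (use \<sigma> n in simp)
qed

text \<open>Telescoping; the last term \<open>r (Suc N)\<close> is dropped because it is
  nonnegative.\<close>

lemma sum_le_of_descent:
  fixes r a :: "nat \<Rightarrow> real"
  assumes "\<And>k. r (Suc k) + h * a k \<le> r k + c" and "\<And>k. 0 \<le> r k"
  shows "h * (\<Sum>k = 0..N. a k) \<le> r 0 + real (N + 1) * c"
proof -
  have "r (Suc N) + h * (\<Sum>k = 0..N. a k) \<le> r 0 + real (N + 1) * c"
  proof (induction N)
    case 0
    show ?case using assms(1)[of 0] by simp
  next
    case (Suc N)
    then show ?case using assms(1)[of "Suc N"] by (simp add: algebra_simps)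
  qed
  then show ?thesis using assms(2)[of "Suc N"] by linarith
qed

subsection \<open>The STARS iteration\<close>

theorem theorem2:
  fixes f :: "real^'n \<Rightarrow> real" and g :: "real^'n \<Rightarrow> real^'n"
    and L1 sigma :: real and xstar x0 :: "real^'n"
    and M :: "'a measure"
    and Z :: "(nat \<times> 'n) + (bool \<times> nat) \<Rightarrow> 'a \<Rightarrow> real"
    and N :: nat
  assumes convex: "convex_on UNIV f"
    and grad: "\<And>x. (f has_derivative (\<lambda>v. g x \<bullet> v)) (at x)"
    and lip: "\<And>x y. norm (g x - g y) \<le> L1 * norm (x - y)"
    and L1_pos: "L1 > 0"
    and minimizer: "\<And>x. f xstar \<le> f x"
    and sigma_pos: "sigma > 0"
    and P: "prob_space M"
    and indep: "prob_space.indep_vars M (\<lambda>_. borel) Z UNIV"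
    and gauss: "\<And>k i. distributed M lborel (Z (Inl (k, i))) (\<lambda>t. ennreal (std_normal_density t))"
    and noise_sq: "\<And>j. integrable M (\<lambda>\<omega>. (Z (Inr j) \<omega>)\<^sup>2)"
    and noise_mean: "\<And>j. prob_space.expectation M (Z (Inr j)) = 0"
    and noise_var: "\<And>j. prob_space.variance M (Z (Inr j)) = sigma\<^sup>2"
    and noise_id: "\<And>j j'. distr M borel (Z (Inr j)) = distr M borel (Z (Inr j'))"
  shows
   "(let n = real CARD('n);
         mu = (8 * sigma\<^sup>2 * n / (L1\<^sup>2 * (n + 6) ^ 3)) powr (1/4);
         h = 1 / (4 * L1 * (n + 4));
         x = (\<lambda>\<omega> k. stars_iter f h mu x0
                (\<lambda>k. \<chi> i. Z (Inl (k, i)) \<omega>)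
                (\<lambda>k. Z (Inr (False, k)) \<omega>) (\<lambda>k. Z (Inr (True, k)) \<omega>) k);
         phi = (\<lambda>k. if k = 0 then f x0 else prob_space.expectation M (\<lambda>\<omega>. f (x \<omega> k)))
     in (1 / real (N + 1)) * (\<Sum>k = 0..N. (phi k - f xstar))
        \<le> 4 * L1 * (n + 4) / real (N + 1) * (norm (x0 - xstar))\<^sup>2
           + 3 * sqrt 2 / 5 * sigma * (n + 4))"
proof -
  interpret prob_space M by (rule P)
  define n where "n = real CARD('n)"
  define mu where "mu = (8 * sigma\<^sup>2 * n / (L1\<^sup>2 * (n + 6) ^ 3)) powr (1/4)"
  define h where "h = 1 / (4 * L1 * (n + 4))"
  \<comment> \<open>\<open>Z\<close> holds all scalar randomness in one independent family:
    \<open>Inl (k, i)\<close> is coordinate \<open>i\<close> of direction \<open>k\<close>, and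
    \<open>Inr (True, k)\<close> and \<open>Inr (False, k)\<close> are the noises at the shifted and
    the current point. A step sees only the noise difference \<open>W\<close>.\<close>
  define U where "U k \<omega> = (\<chi> i. Z (Inl (k, i)) \<omega>)" for k \<omega>
  define W where "W k \<omega> = Z (Inr (True, k)) \<omega> - Z (Inr (False, k)) \<omega>" for k \<omega>
  \<comment> \<open>The iterate as a deterministic function of the sample values, so that
    measurability and dependence can be stated on the product space.\<close>
  define p where "p k z = stars_iter f h mu x0 (\<lambda>k. \<chi> i. z (Inl (k, i)))
      (\<lambda>k. z (Inr (False, k))) (\<lambda>k. z (Inr (True, k))) k" for k and z :: "(nat \<times> 'n) + (bool \<times> nat) \<Rightarrow> real"
  define X where "X k \<omega> = p k (\<lambda>j. Z j \<omega>)" for k \<omega>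
  define step where "step x v w = x - (h * ((f (x + mu *\<^sub>R v) - f x + w) / mu)) *\<^sub>R v" for x v :: "real^'n" and w
  \<comment> \<open>The indices read by the first \<open>k\<close> steps; index \<open>k\<close>
    itself belongs to the fresh randomness.\<close>
  define past :: "nat \<Rightarrow> ((nat \<times> 'n) + (bool \<times> nat)) set"
    where "past k = Inl ` ({..<k} \<times> UNIV) \<union> Inr ` (UNIV \<times> {..<k})" for k
  define c where "c = mu\<^sup>2 * L1 * n + h * (mu\<^sup>2 * L1\<^sup>2 / 2 * (n * (n + 2) * (n + 4)) + 2 * sigma\<^sup>2 * n / mu\<^sup>2)"
  have n: "n > 0" by (simp add: n_def)
  have mu: "mu > 0" using n L1_pos sigma_pos by (simp add: mu_def)
  have "mu ^ 4 = mu powr 4" using mu by (simp add: powr_numeral)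
  then have mu4: "mu ^ 4 = 8 * sigma\<^sup>2 * n / (L1\<^sup>2 * (n + 6) ^ 3)"
    using n by (simp add: mu_def powr_powr abs_mult power_abs)
  have h: "h > 0" using n L1_pos by (simp add: h_def)

  interpret lipschitz_gradient f g L1 by unfold_locales (rule grad lip L1_pos)+
  have [measurable]: "f \<in> borel_measurable borel"
    using continuous by (rule borel_measurable_continuous_onI)
  have [measurable]: "Z j \<in> borel_measurable M" for j
    using indep by (simp add: indep_vars_def)

  have p_Suc: "p (Suc k) z = step (p k z) (\<chi> i. z (Inl (k, i))) (z (Inr (True, k)) - z (Inr (False, k)))" for k z
    by (simp add: p_def step_def Let_def algebra_simps)
  have X_Suc: "X (Suc k) \<omega> = step (X k \<omega>) (U k \<omega>) (W k \<omega>)" for k \<omega>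
    by (simp add: X_def p_Suc U_def W_def)
  have step_measurable: "(\<lambda>(x, v, w). step x v w) \<in> borel_measurable (borel \<Otimes>\<^sub>M borel \<Otimes>\<^sub>M borel)"
    unfolding step_def by measurable
  \<comment> \<open>Stated for every \<open>A\<close> containing \<open>past k\<close>, so that the
    induction keeps one product space while \<open>k\<close> grows.\<close>
  have p_measurable: "past k \<subseteq> A \<Longrightarrow> p k \<in> borel_measurable (PiM A (\<lambda>_. borel))" for k A
  proof (induction k)
    case 0
    show ?case by (simp add: p_def)
  next
    case (Suc k)
    have "past k \<subseteq> A" using Suc.prems by (auto simp: past_def)
    then have [measurable]: "p k \<in> borel_measurable (PiM A (\<lambda>_. borel))" by (rule Suc.IH)
    have "Inl (k, i) \<in> A" "Inr (b, k) \<in> A" for i b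
      using Suc.prems by (auto simp: past_def)
    then have [measurable]: "(\<lambda>z. \<chi> i. z (Inl (k, i))) \<in> borel_measurable (PiM A (\<lambda>_. borel :: real measure))"
      "(\<lambda>z. z (Inr (b, k))) \<in> borel_measurable (PiM A (\<lambda>_. borel :: real measure))" for b
      by (auto intro!: borel_measurable_vec_lambda measurable_component_singleton)
    have "(\<lambda>z. (p k z, \<chi> i. z (Inl (k, i)), z (Inr (True, k)) - z (Inr (False, k))))
        \<in> measurable (PiM A (\<lambda>_. borel)) (borel \<Otimes>\<^sub>M borel \<Otimes>\<^sub>M borel)"
      by measurable
    from measurable_compose[OF this step_measurable] show ?case
      by (simp add: p_Suc[abs_def])
  qed
  \<comment> \<open>Restriction changes only values that the first \<open>k\<close> steps never
    read.\<close>
  have p_restrict: "past k \<subseteq> A \<Longrightarrow> p k (restrict z A) = p k z" for k z A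
  proof (induction k)
    case 0
    show ?case by (simp add: p_def)
  next
    case (Suc k)
    have "past k \<subseteq> A" using Suc.prems by (auto simp: past_def)
    moreover have "Inl (k, i) \<in> A" "Inr (b, k) \<in> A" for i b
      using Suc.prems by (auto simp: past_def)
    ultimately show ?case
      using Suc.IH by (simp add: p_Suc)
  qed

  \<comment> \<open>The iterate reads indices in \<open>past k\<close>; the direction and noise of
    step \<open>k\<close> have indices in its complement.\<close>
  have indep_step: "indep_pair borel (X k) (borel \<Otimes>\<^sub>M borel) (\<lambda>\<omega>. (U k \<omega>, W k \<omega>))" for k
  proof (rule indep_vars_imp_indep_pair[OF indep, where A = "past k" and B = "- past k" and p = "p k"
        and q = "\<lambda>z. (\<chi> i. z (Inl (k, i)), z (Inr (True, k)) - z (Inr (False, k)))"])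
    have "Inl (k, i) \<in> - past k" "Inr (b, k) \<in> - past k" for i b
      by (auto simp: past_def)
    then have [measurable]: "(\<lambda>z. \<chi> i. z (Inl (k, i))) \<in> borel_measurable (PiM (- past k) (\<lambda>_. borel :: real measure))"
      "(\<lambda>z. z (Inr (b, k))) \<in> borel_measurable (PiM (- past k) (\<lambda>_. borel :: real measure))" for b
      by (auto intro!: borel_measurable_vec_lambda measurable_component_singleton)
    show "(\<lambda>z. (\<chi> i. z (Inl (k, i)), z (Inr (True, k)) - z (Inr (False, k))))
        \<in> measurable (PiM (- past k) (\<lambda>_. borel :: real measure)) (borel \<Otimes>\<^sub>M borel)"
      by measurable
  qed (auto simp: X_def p_restrict p_measurable U_def W_def past_def)

  have indep_UW: "indep_pair borel (U k) borel (W k)" for k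
  proof (rule indep_vars_imp_indep_pair[OF indep, where A = "range Inl" and B = "range Inr"
        and p = "\<lambda>z. \<chi> i. z (Inl (k, i))" and q = "\<lambda>z. z (Inr (True, k)) - z (Inr (False, k))"])
    show "(\<lambda>z. \<chi> i. z (Inl (k, i))) \<in> borel_measurable (PiM (range Inl) (\<lambda>_. borel :: real measure))"
      by (auto intro!: borel_measurable_vec_lambda measurable_component_singleton)
    show "(\<lambda>z. z (Inr (True, k)) - z (Inr (False, k))) \<in> borel_measurable (PiM (range Inr) (\<lambda>_. borel :: real measure))"
      by (auto intro!: borel_measurable_diff measurable_component_singleton)
  qed (auto simp: U_def W_def)

  have gaussian: "standard_gaussian_vector M (U k)" for k
  proof
    \<comment> \<open>Singleton blocks reindex the family by the coordinate \<open>i\<close>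
      alone.\<close>
    have "indep_vars (\<lambda>i. PiM {Inl (k, i)} (\<lambda>_. borel)) (\<lambda>i \<omega>. restrict (\<lambda>j. Z j \<omega>) {Inl (k, i)}) (UNIV :: 'n set)"
      by (rule indep_vars_restrict[OF indep]) (auto simp: disjoint_family_on_def)
    from indep_vars_compose2[OF this, of "\<lambda>i z. z (Inl (k, i))" "\<lambda>_. borel"]
    show "indep_vars (\<lambda>_. borel) (\<lambda>i \<omega>. U k \<omega> $ i) UNIV"
      by (simp add: U_def measurable_component_singleton)
    show "distributed M lborel (\<lambda>\<omega>. U k \<omega> $ i) std_normal_density" for i
      using gauss by (simp add: U_def)
  qed

  have Z_int: "integrable M (Z (Inr j))" for j
    by (rule square_integrable_imp_integrable) (use noise_sq in auto)
  have Z_sq: "expectation (\<lambda>\<omega>. (Z (Inr j) \<omega>)\<^sup>2) = sigma\<^sup>2" for j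
    using noise_var[of j] by (simp add: noise_mean)
  have Z_indep: "indep_var borel (Z (Inr (True, k))) borel (Z (Inr (False, k)))" for k
    by (rule indep_pair_imp_indep_var, rule indep_vars_imp_indep_pair[OF indep,
          where A = "{Inr (True, k)}" and B = "{Inr (False, k)}"
            and p = "\<lambda>z. z (Inr (True, k))" and q = "\<lambda>z. z (Inr (False, k))"])
       (auto intro: measurable_component_singleton)
  have W_mean: "expectation (W k) = 0" for k
    unfolding W_def using Z_int by (simp add: noise_mean)
  have W_eq: "(W k \<omega>)\<^sup>2 = (Z (Inr (True, k)) \<omega>)\<^sup>2 + (Z (Inr (False, k)) \<omega>)\<^sup>2
      - 2 * (Z (Inr (True, k)) \<omega> * Z (Inr (False, k)) \<omega>)" for k \<omega>
    by (simp add: W_def power2_diff)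
  have W_sq_int: "integrable M (\<lambda>\<omega>. (W k \<omega>)\<^sup>2)" for k
    unfolding W_eq using noise_sq indep_var_integrable[OF Z_indep Z_int Z_int] by simp
  \<comment> \<open>Two independent centred noises enter each difference, which doubles the
    variance.\<close>
  have W_sq: "expectation (\<lambda>\<omega>. (W k \<omega>)\<^sup>2) = 2 * sigma\<^sup>2" for k
    unfolding W_eq
    using noise_sq indep_var_integrable[OF Z_indep Z_int Z_int] indep_var_lebesgue_integral[OF Z_indep Z_int Z_int]
    by (simp add: Z_sq noise_mean)

  have smoothed: "smoothed_objective M (U k) f g L1 mu xstar" for k
  proof -
    interpret standard_gaussian_vector M "U k" by (rule gaussian)
    show ?thesis by unfold_locales (use convex minimizer mu in auto)
  qed
  have one_step_int: "integrable M (\<lambda>\<omega>. (norm (step x (U k \<omega>) (W k \<omega>) - xstar))\<^sup>2)" for x k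
    unfolding step_def
    by (rule smoothed_objective.noisy_step(1)[OF smoothed indep_UW W_sq_int W_sq W_mean h])
  have one_step: "expectation (\<lambda>\<omega>. (norm (step x (U k \<omega>) (W k \<omega>) - xstar))\<^sup>2)
      \<le> (norm (x - xstar))\<^sup>2 - h * (f x - f xstar) + h * c" for x k
  proof -
    \<comment> \<open>Naming the quotient keeps the rearrangement below a polynomial
      identity.\<close>
    define T where "T = 2 * sigma\<^sup>2 * n / mu\<^sup>2"
    have h1: "h * (4 * L1 * (n + 4)) = 1" using n L1_pos by (simp add: h_def)
    \<comment> \<open>The choice of \<open>h\<close> is used here: after \<open>n + 2\<close> is
      enlarged to \<open>n + 4\<close>, the right side collapses to exactly
      \<open>h * (f x - f xstar)\<close>.\<close>
    have "h\<^sup>2 * (2 * (n + 2) * (norm (g x))\<^sup>2) \<le> h\<^sup>2 * (2 * (n + 4) * (2 * L1 * (f x - f xstar)))"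
      using n by (intro mult_left_mono mult_mono norm_gradient_sq_le minimizer) auto
    also have "\<dots> = h * (f x - f xstar)"
      using h1 by algebra
    finally have "h\<^sup>2 * (2 * (n + 2) * (norm (g x))\<^sup>2) \<le> h * (f x - f xstar)" .
    moreover have "expectation (\<lambda>\<omega>. (norm (step x (U k \<omega>) (W k \<omega>) - xstar))\<^sup>2)
      \<le> (norm (x - xstar))\<^sup>2 - 2 * h * (f x - f xstar - mu\<^sup>2 * L1 * n / 2)
      + h\<^sup>2 * (mu\<^sup>2 * L1\<^sup>2 / 2 * (n * (n + 2) * (n + 4)) + 2 * (n + 2) * (norm (g x))\<^sup>2 + 2 * sigma\<^sup>2 * n / mu\<^sup>2)"
      unfolding step_def n_def
      by (rule smoothed_objective.noisy_step(2)[OF smoothed indep_UW W_sq_int W_sq W_mean h])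
    moreover have "(norm (x - xstar))\<^sup>2 - 2 * h * (f x - f xstar - mu\<^sup>2 * L1 * n / 2)
      + h\<^sup>2 * (mu\<^sup>2 * L1\<^sup>2 / 2 * (n * (n + 2) * (n + 4)) + 2 * (n + 2) * (norm (g x))\<^sup>2 + T)
      = (norm (x - xstar))\<^sup>2 - 2 * (h * (f x - f xstar)) + h * c + h\<^sup>2 * (2 * (n + 2) * (norm (g x))\<^sup>2)"
      unfolding c_def T_def[symmetric] by algebra
    ultimately show ?thesis
      unfolding T_def[symmetric] by linarith
  qed

  \<comment> \<open>The gap is between \<open>0\<close> and a multiple of the squared distance to
    the minimizer, so the second moment of the iterate suffices.\<close>
  have f_int: "integrable M (\<lambda>\<omega>. f (X k \<omega>))"
    if "integrable M (\<lambda>\<omega>. (norm (X k \<omega> - xstar))\<^sup>2)" for k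
  proof -
    have [measurable]: "X k \<in> borel_measurable M"
      using indep_step[of k] by (simp add: indep_pair_def)
    have "integrable M (\<lambda>\<omega>. f (X k \<omega>) - f xstar)"
    proof (rule Bochner_Integration.integrable_bound)
      show "integrable M (\<lambda>\<omega>. L1 / 2 * (norm (X k \<omega> - xstar))\<^sup>2)" using that by simp
      show "AE \<omega> in M. norm (f (X k \<omega>) - f xstar) \<le> norm (L1 / 2 * (norm (X k \<omega> - xstar))\<^sup>2)"
        using smoothed_objective.minimizer_quadratic_bound[OF smoothed] minimizer L1_pos by simp
    qed simp
    from Bochner_Integration.integrable_add[OF this, of "\<lambda>_. f xstar"] show ?thesis by simp
  qed
  have X_step: "integrable M (\<lambda>\<omega>. (norm (X (Suc k) \<omega> - xstar))\<^sup>2)"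
    "expectation (\<lambda>\<omega>. (norm (X (Suc k) \<omega> - xstar))\<^sup>2) + h * (expectation (\<lambda>\<omega>. f (X k \<omega>)) - f xstar)
      \<le> expectation (\<lambda>\<omega>. (norm (X k \<omega> - xstar))\<^sup>2) + h * c"
    if int: "integrable M (\<lambda>\<omega>. (norm (X k \<omega> - xstar))\<^sup>2)" for k
  proof -
    define F where "F = (\<lambda>(x, v, w). (norm (step x v w - xstar))\<^sup>2)"
    define G where "G x = (norm (x - xstar))\<^sup>2 - h * (f x - f xstar) + h * c" for x
    have F: "F \<in> borel_measurable (borel \<Otimes>\<^sub>M borel \<Otimes>\<^sub>M borel)"
      unfolding F_def step_def by measurable
    have G: "integrable M (\<lambda>\<omega>. G (X k \<omega>))"
      unfolding G_def using int f_int[OF int] by simp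
    have F_nonneg: "0 \<le> F z" for z by (simp add: F_def split: prod.split)
    have F_int: "integrable M (\<lambda>\<omega>. F (x, U k \<omega>, W k \<omega>))" for x by (simp add: F_def one_step_int)
    have F_le: "expectation (\<lambda>\<omega>. F (x, U k \<omega>, W k \<omega>)) \<le> G x" for x
      using one_step by (simp add: F_def G_def)
    note * = indep_pair_expectation_le[OF indep_step F F_nonneg F_int F_le G]
    show "integrable M (\<lambda>\<omega>. (norm (X (Suc k) \<omega> - xstar))\<^sup>2)"
      using *(1) by (simp add: F_def X_Suc)
    show "expectation (\<lambda>\<omega>. (norm (X (Suc k) \<omega> - xstar))\<^sup>2) + h * (expectation (\<lambda>\<omega>. f (X k \<omega>)) - f xstar)
      \<le> expectation (\<lambda>\<omega>. (norm (X k \<omega> - xstar))\<^sup>2) + h * c"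
      using *(2) int f_int[OF int] by (simp add: F_def G_def X_Suc prob_space algebra_simps)
  qed
  have X_0: "X 0 \<omega> = x0" for \<omega> by (simp add: X_def p_def)
  \<comment> \<open>The second moment is finite at the constant start \<open>x0\<close> and is
    passed on by \<open>X_step\<close>.\<close>
  have X_int: "integrable M (\<lambda>\<omega>. (norm (X k \<omega> - xstar))\<^sup>2)" for k
    by (induction k) (simp_all add: X_0 X_step)
  define S where "S = (\<Sum>k = 0..N. (expectation (\<lambda>\<omega>. f (X k \<omega>)) - f xstar))"
  have "h * S \<le> expectation (\<lambda>\<omega>. (norm (X 0 \<omega> - xstar))\<^sup>2) + real (N + 1) * (h * c)"
    unfolding S_def
    by (rule sum_le_of_descent[where r = "\<lambda>k. expectation (\<lambda>\<omega>. (norm (X k \<omega> - xstar))\<^sup>2)"])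
       (simp_all add: X_step(2)[OF X_int])
  then have "h * S \<le> (norm (x0 - xstar))\<^sup>2 + real (N + 1) * (h * c)"
    by (simp add: X_0 prob_space)
  then have "S \<le> (norm (x0 - xstar))\<^sup>2 / h + real (N + 1) * c"
    using h by (simp add: field_simps)
  \<comment> \<open>Averaging leaves \<open>c\<close> intact, and \<open>1 / h\<close> supplies the
    factor \<open>4 * L1 * (n + 4)\<close>.\<close>
  then have "1 / real (N + 1) * S \<le> 1 / real (N + 1) * ((norm (x0 - xstar))\<^sup>2 / h + real (N + 1) * c)"
    by (intro mult_left_mono) auto
  also have "\<dots> = 4 * L1 * (n + 4) / real (N + 1) * (norm (x0 - xstar))\<^sup>2 + c"
    by (simp add: h_def field_simps)
  also have "c \<le> 3 * sqrt 2 / 5 * sigma * (n + 4)"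
    unfolding c_def using n L1_pos sigma_pos mu mu4 h_def by (intro step_constant_bound) auto
  finally have main: "1 / real (N + 1) * S
      \<le> 4 * L1 * (n + 4) / real (N + 1) * (norm (x0 - xstar))\<^sup>2 + 3 * sqrt 2 / 5 * sigma * (n + 4)"
    by simp
  \<comment> \<open>The separate value of \<open>phi\<close> at \<open>0\<close> agrees with the
    expectation, since \<open>X 0\<close> is constantly \<open>x0\<close>.\<close>
  have "S = (\<Sum>k = 0..N. (if k = 0 then f x0 else expectation (\<lambda>\<omega>. f (X k \<omega>))) - f xstar)"
    unfolding S_def by (intro sum.cong) (auto simp: X_0 prob_space)
  with main show ?thesis
    unfolding Let_def n_def[symmetric] mu_def[symmetric] h_def[symmetric] X_def p_def by simp
qed

end
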